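(* Let $n\ge 2$. For any radial function $f\in C_c^\infty(N_{n,2})$ and any $t\ge 0$, one has pointwise on $N_{n,2}$ $$|\nabla P_tf|\le P_t(|\nabla f|).$$
   Context: Let $n\ge 2$. $N_{n,2}$ is the simply connected nilpotent Lie group of rank (step) two with $n$ generators, identified with $\mathbb{R}^{n}\times\mathbb{R}^{n(n-1)/2}$ with coordinates $(\vec x,\vec y)=\big((x_i)_{1\le i\le n},(y_{ij})_{1\le i<j\le n}\big)$. Write $\partial_i=\partial/\partial x_i$, $\hat\partial_{ij}=\partial/\partial y_{ij}$ for $i<j$. The vector fields $$X_i=\partial_i+\tfrac12\Big(\sum_{k<i}x_k\hat\partial_{ki}-\sum_{k>i}x_k\hat\partial_{ik}\Big),\quad 1\le i\le n,$$ are left invariant for the group law $(\vec x,\vec y)\circ(\vec x',\vec y')=\big(\vec x+\vec x',\,(y_{ij}+y'_{ij}+\tfrac12(x_ix'_j-x_jx'_i))_{i<j}\big)$. The sub-Laplacian is $\Delta=\sum_{i=1}^n X_i^2$, and $P_t=e^{t\Delta}$, $t\ge 0$, is the associated heat semigroup. The horizontal gradient is $\nabla f=(X_1f,\dots,X_nf)$, with Euclidean norm $|\nabla f|=\big(\sum_{i=1}^n(X_if)^2\big)^{1/2}$. For $1\le i<j\le n$ define the rotation vector fields $$\theta_{ij}=x_j\partial_i-x_i\partial_j+\sum_{1\le k<i}(y_{kj}\hat\partial_{ki}-y_{ki}\hat\partial_{kj})+\sum_{i<k<j}(y_{ik}\hat\partial_{kj}-y_{kj}\hat\partial_{ik})+\sum_{j<k\le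 n}(y_{jk}\hat\partial_{ik}-y_{ik}\hat\partial_{jk}).$$ A $C^2$ function $f:N_{n,2}\to\mathbb{R}$ is called radial if $\theta_{ij}f=0$ for all $1\le i<j\le n$. *)

theory Defs
  imports "HOL-Analysis.Analysis"
begin

section \<open>The underlying space of the group\<close>

text \<open>
  The generators are indexed by an arbitrary finite linear order \<open>'n\<close> with
  \<open>n = CARD('n) \<ge> 2\<close> (class \<open>card2\<close>; for instance the numeral types \<open>2\<close>, \<open>3\<close>, \dots).
  The second-layer coordinates \<open>y\<^sub>i\<^sub>j\<close> are indexed by the pairs \<open>i < j\<close>, which form a
  finite type with \<open>n(n-1)/2\<close> elements.
\<close>

typedef (overloaded) 'n ordpair = "{(i::'n::{card2,linorder}, j). i < j}"
proof -
  have "\<exists>a b :: 'n. a \<noteq> b"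
  proof (rule ccontr)
    assume "\<not> ?thesis"
    then have "(UNIV :: 'n set) \<subseteq> {undefined}" by auto
    then have "CARD('n) \<le> 1" using card_mono[of "{undefined :: 'n}" UNIV] by simp
    then show False using two_le_card[where 'a = 'n] by simp
  qed
  then obtain a b :: 'n where "a < b" using linorder_neq_iff by blast
  then show ?thesis by auto
qed

instance ordpair :: ("{card2,linorder}") finite
proof
  have "inj (Rep_ordpair :: 'a ordpair \<Rightarrow> _)"
    by (simp add: inj_def Rep_ordpair_inject)
  then show "finite (UNIV :: 'a ordpair set)"
    by (rule finite_imageD[rotated]) simp
qed

lemma card_ordpair: "CARD('n::{card2,linorder} ordpair) = CARD('n) * (CARD('n) - 1) div 2"
proof -
  let ?L = "{(i::'n, j). i < j}" and ?G = "{(i::'n, j). j < i}" and ?D = "range (\<lambda>i::'n. (i, i))"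
  have "CARD('n ordpair) = card ?L"
    using type_definition.card[OF type_definition_ordpair[where 'n = 'n]] .
  moreover have "card ?G = card ?L"
    by (rule bij_betw_same_card[of prod.swap]) (auto simp: bij_betw_def inj_on_def image_iff)
  moreover have "card ?D = CARD('n)"
    by (rule card_image) (auto simp: inj_on_def)
  moreover have "card ((?L \<union> ?G) \<union> ?D) = card (?L \<union> ?G) + card ?D"
    by (rule card_Un_disjoint) auto
  moreover have "card (?L \<union> ?G) = card ?L + card ?G"
    by (rule card_Un_disjoint) auto
  moreover have "(?L \<union> ?G) \<union> ?D = (UNIV :: ('n \<times> 'n) set)"
    by (auto simp: image_iff)
  moreover have "card (UNIV :: ('n \<times> 'n) set) = CARD('n) * CARD('n)"
    by (simp add: card_prod)
  ultimately have "CARD('n) * CARD('n) = 2 * CARD('n ordpair) + CARD('n)" by simp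
  then have "CARD('n) * (CARD('n) - 1) = 2 * CARD('n ordpair)"
    by (simp add: right_diff_distrib')
  then show ?thesis by simp
qed

type_synonym 'n nil2 = "(real^'n) \<times> (real^'n ordpair)"

text \<open>The coordinate functions \<open>x\<^sub>i\<close> and, for \<open>i < j\<close> only, \<open>y\<^sub>i\<^sub>j\<close>.\<close>

definition xc :: "'n::{card2,linorder} \<Rightarrow> 'n nil2 \<Rightarrow> real" where
  "xc i p = fst p $ i"

definition yc :: "'n::{card2,linorder} \<Rightarrow> 'n \<Rightarrow> 'n nil2 \<Rightarrow> real" where
  "yc i j p = snd p $ Abs_ordpair (i, j)"

text \<open>The partial derivatives \<open>\<partial>/\<partial>x\<^sub>i\<close> and, for \<open>i < j\<close> only, \<open>\<partial>/\<partial>y\<^sub>i\<^sub>j\<close>.\<close>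

definition dx :: "'n::{card2,linorder} \<Rightarrow> ('n nil2 \<Rightarrow> real) \<Rightarrow> 'n nil2 \<Rightarrow> real" where
  "dx i f p = frechet_derivative f (at p) (axis i 1, 0)"

definition dy :: "'n::{card2,linorder} \<Rightarrow> 'n \<Rightarrow> ('n nil2 \<Rightarrow> real) \<Rightarrow> 'n nil2 \<Rightarrow> real" where
  "dy i j f p = frechet_derivative f (at p) (0, axis (Abs_ordpair (i, j)) 1)"

section \<open>Left-invariant fields, sub-Laplacian and rotations\<close>

text \<open>
  These fields are left invariant for the group law
  \<open>(x, y) \<circ> (x', y') = (x + x', (y\<^sub>i\<^sub>j + y'\<^sub>i\<^sub>j + (x\<^sub>i x'\<^sub>j - x\<^sub>j x'\<^sub>i) / 2)\<^sub>i\<^sub><\<^sub>j)\<close>.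
\<close>

definition Xf :: "'n::{card2,linorder} \<Rightarrow> ('n nil2 \<Rightarrow> real) \<Rightarrow> 'n nil2 \<Rightarrow> real" where
  "Xf i f p = dx i f p
     + (1/2) * ((\<Sum>k\<in>{..<i}. xc k p * dy k i f p) - (\<Sum>k\<in>{i<..}. xc k p * dy i k f p))"

definition hgrad :: "('n::{card2,linorder} nil2 \<Rightarrow> real) \<Rightarrow> 'n nil2 \<Rightarrow> (real, 'n) vec" where
  "hgrad f p = (\<chi> i. Xf i f p)"

definition subLaplacian :: "('n::{card2,linorder} nil2 \<Rightarrow> real) \<Rightarrow> 'n nil2 \<Rightarrow> real" where
  "subLaplacian f p = (\<Sum>i\<in>UNIV. Xf i (Xf i f) p)"

definition rot :: "'n::{card2,linorder} \<Rightarrow> 'n \<Rightarrow> ('n nil2 \<Rightarrow> real) \<Rightarrow> 'n nil2 \<Rightarrow> real" where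
  "rot i j f p = xc j p * dx i f p - xc i p * dx j f p
     + (\<Sum>k\<in>{..<i}. yc k j p * dy k i f p - yc k i p * dy k j f p)
     + (\<Sum>k\<in>{i<..<j}. yc i k p * dy k j f p - yc k j p * dy i k f p)
     + (\<Sum>k\<in>{j<..}. yc j k p * dy i k f p - yc i k p * dy j k f p)"

section \<open>Function spaces\<close>

text \<open>
  \<open>C^k\<close> on a Euclidean space: \<open>f\<close> is (Frechet) differentiable and all its
  directional derivatives are \<open>C^(k-1)\<close>.
\<close>

primrec Ck :: "nat \<Rightarrow> ('a::euclidean_space \<Rightarrow> real) \<Rightarrow> bool" where
  "Ck 0 f \<longleftrightarrow> continuous_on UNIV f"
| "Ck (Suc k) f \<longleftrightarrow> (\<forall>p. f differentiable (at p)) \<and>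
     (\<forall>v. Ck k (\<lambda>p. frechet_derivative f (at p) v))"

definition Cc_infinity :: "('a::euclidean_space \<Rightarrow> real) set" where
  "Cc_infinity = {f. (\<forall>k. Ck k f) \<and> compact (closure {p. f p \<noteq> 0})}"

definition C_zero :: "('a::euclidean_space \<Rightarrow> real) set" where
  "C_zero = {f. continuous_on UNIV f \<and> (f \<longlongrightarrow> 0) at_infinity}"

definition sup_norm :: "('a \<Rightarrow> real) \<Rightarrow> real" where
  "sup_norm f = (SUP p. \<bar>f p\<bar>)"

definition radial :: "('n::{card2,linorder} nil2 \<Rightarrow> real) \<Rightarrow> bool" where
  "radial f \<longleftrightarrow> Ck 2 f \<and> (\<forall>i j. i < j \<longrightarrow> (\<forall>p. rot i j f p = 0))"

section \<open>The heat semigroup\<close>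

text \<open>
  Strongly continuous one-parameter semigroups of bounded linear operators on the Banach
  space \<open>C_zero\<close> with the sup norm. Only the values \<open>P t f\<close> for \<open>t \<ge> 0\<close> and \<open>f \<in> C_zero\<close>
  are constrained.
\<close>

definition C0_semigroup ::
    "(real \<Rightarrow> ('a::euclidean_space \<Rightarrow> real) \<Rightarrow> ('a \<Rightarrow> real)) \<Rightarrow> bool" where
  "C0_semigroup P \<longleftrightarrow>
     (\<forall>t\<ge>0. \<forall>f\<in>C_zero. P t f \<in> C_zero) \<and>
     (\<forall>t\<ge>0. \<forall>f\<in>C_zero. \<forall>g\<in>C_zero. \<forall>a b.
        P t (\<lambda>p. a * f p + b * g p) = (\<lambda>p. a * P t f p + b * P t g p)) \<and>
     (\<forall>t\<ge>0. \<exists>K. \<forall>f\<in>C_zero. sup_norm (P t f) \<le> K * sup_norm f) \<and>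
     (\<forall>f\<in>C_zero. P 0 f = f) \<and>
     (\<forall>s\<ge>0. \<forall>t\<ge>0. \<forall>f\<in>C_zero. P (s + t) f = P s (P t f)) \<and>
     (\<forall>f\<in>C_zero. uniform_limit UNIV (\<lambda>t. P t f) f (at_right 0))"

text \<open>The infinitesimal generator, as a graph in \<open>C_zero \<times> C_zero\<close>.\<close>

definition generator ::
    "(real \<Rightarrow> ('a::euclidean_space \<Rightarrow> real) \<Rightarrow> ('a \<Rightarrow> real)) \<Rightarrow> (('a \<Rightarrow> real) \<times> ('a \<Rightarrow> real)) set" where
  "generator P = {(f, g). f \<in> C_zero \<and> g \<in> C_zero \<and>
     uniform_limit UNIV (\<lambda>t p. (P t f p - f p) / t) g (at_right 0)}"

text \<open>The graph of the closure in \<open>C_zero\<close> of the operator \<open>L\<close> with domain \<open>Cc_infinity\<close>.\<close>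

definition closure_graph ::
    "(('a::euclidean_space \<Rightarrow> real) \<Rightarrow> ('a \<Rightarrow> real)) \<Rightarrow> (('a \<Rightarrow> real) \<times> ('a \<Rightarrow> real)) set" where
  "closure_graph L = {(f, g). f \<in> C_zero \<and> g \<in> C_zero \<and>
     (\<exists>u. (\<forall>m::nat. u m \<in> Cc_infinity) \<and>
          uniform_limit UNIV u f sequentially \<and>
          uniform_limit UNIV (\<lambda>m. L (u m)) g sequentially)}"

text \<open>
  \<open>P\<^sub>t = exp (t \<Delta>)\<close>: the semigroup generated by the (closure of the) sub-Laplacian.
  A strongly continuous semigroup is determined on \<open>C_zero\<close> by its generator, so at most one
  family of operators on \<open>C_zero\<close> satisfies this predicate.
\<close>

definition heat_semigroup ::
    "(real \<Rightarrow> ('n::{card2,linorder} nil2 \<Rightarrow> real) \<Rightarrow> ('n nil2 \<Rightarrow> real)) \<Rightarrow> bool" where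
  "heat_semigroup P \<longleftrightarrow> C0_semigroup P \<and> generator P = closure_graph subLaplacian"

end

theory Submission
  imports Defs
begin

text \<open>
  The sub-Laplacian commutes with left translations, hence so does \<open>P\<^sub>t\<close>, and the right
  invariant fields, which generate the left translations, commute with \<open>P\<^sub>t\<close>. As they span the
  tangent space at every point, \<open>P\<^sub>t f\<close> is differentiable without any appeal to
  hypoellipticity. In the same way \<open>P\<^sub>t\<close> commutes with rotations, so \<open>P\<^sub>t f\<close> is radial when
  \<open>f\<close> is. For a radial function the left and the right invariant horizontal gradients have the
  same length: the difference of their squares is the trace of a product of a symmetric and an
  antisymmetric matrix. Passing to the right invariant gradient on both sides, the claim is the
  inequality \<open>\<bar>P\<^sub>t (g\<^sub>1, \<dots>, g\<^sub>n)\<bar> \<le> P\<^sub>t \<bar>(g\<^sub>1, \<dots>, g\<^sub>n)\<bar>\<close>, which follows from the positivity of \<open>P\<^sub>t\<close>.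
  Positivity, contractivity and the commutation with symmetries all come from the positive maximum
  principle, applied to orbits of the semigroup.
\<close>

text \<open>\<open>heat_semigroup\<close> supplies only a graph: the generator is the closure of the
  sub-Laplacian on \<open>Cc_infinity\<close>. No kernel, no positivity, no norm bound uniform in
  time and no regularity comes with it; each of these has to be read off from the graph. In a form
  that survives uniform limits, the maximum principle is dissipativity for the one-sided norm
  \<open>pos_sup\<close>. It is exploited by backward Euler steps along an orbit, which use points
  of the graph only and never solve a resolvent equation. The geometric obstacle is that the fields
  X_i do not commute with P_t, so positivity cannot be applied to X_i P_t f directly. The exchange
  of the two gradients is pointwise and of first order. This matters because nothing beyond
  differentiability is established for P_t f. The length of the gradient of f is in turn merely
  continuous, so P_t has to be controlled on all of \<open>C_zero\<close> and not only on smooth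
  functions.\<close>

section \<open>Strongly continuous semigroups\<close>

text \<open>Gliding hump: a series with terms of size \<open>3\<^sup>-\<^sup>n\<close> on which \<open>A (k n)\<close> grows like \<open>(4/3)\<^sup>n\<close>.\<close>

lemma banach_steinhaus_seq:
  fixes A :: "nat \<Rightarrow> 'a::banach \<Rightarrow> 'b::real_normed_vector"
  assumes lin: "\<And>n. bounded_linear (A n)"
    and bdd: "\<And>x. bounded (range (\<lambda>n. A n x))"
  shows "\<exists>M. \<forall>n x. norm (A n x) \<le> M * norm x"
proof (rule ccontr)
  assume neg: "\<not> ?thesis"
  have big: "\<exists>n. onorm (A n) > C" for C
  proof (rule ccontr)
    assume "\<nexists>n. onorm (A n) > C"
    then have "\<forall>n x. norm (A n x) \<le> C * norm x"
      by (meson lin le_less_linear mult_right_mono norm_ge_zero onorm order_trans)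
    with neg show False by blast
  qed
  have "\<forall>n. \<exists>k. onorm (A k) > 4 ^ n" using big by blast
  then obtain k where k: "\<And>n. onorm (A (k n)) > 4 ^ n" by metis
  define B where "B n = A (k n)" for n
  define K where "K n = onorm (B n)" for n
  have linB: "bounded_linear (B n)" for n by (simp add: B_def lin)
  have K4: "K n > 4 ^ n" and K0: "K n > 0" for n
    using k[of n] less_trans[of 0 "4 ^ n :: real" "K n"] by (auto simp: K_def B_def)
  have step: "\<exists>xi. norm xi \<le> (1/3) ^ n \<and> norm (B n (x + xi)) \<ge> 2/3 * (1/3) ^ n * K n" for n x
  proof -
    interpret B: bounded_linear "B n" by (rule linB)
    have "\<exists>z. norm (B n z) > 2/3 * K n * norm z"
    proof (rule ccontr)
      assume "\<nexists>z. norm (B n z) > 2/3 * K n * norm z"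
      then have "onorm (B n) \<le> 2/3 * K n"
        using K0[of n] by (intro onorm_bound) (auto simp: not_less)
      with K0[of n] show False by (simp add: K_def)
    qed
    then obtain z where z: "norm (B n z) > 2/3 * K n * norm z" by blast
    then have "z \<noteq> 0" by (auto simp: B.zero)
    define xi where "xi = ((1/3) ^ n / norm z) *\<^sub>R z"
    have nxi: "norm xi = (1/3) ^ n" using \<open>z \<noteq> 0\<close> by (simp add: xi_def)
    have "norm (B n xi) = (1/3) ^ n / norm z * norm (B n z)"
      by (simp add: xi_def B.scaleR)
    also have "\<dots> \<ge> (1/3) ^ n / norm z * (2/3 * K n * norm z)"
      using z by (intro mult_left_mono) auto
    finally have 1: "norm (B n xi) \<ge> 2/3 * (1/3) ^ n * K n"
      using \<open>z \<noteq> 0\<close> by (simp add: field_simps)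
    \<comment> \<open>At least one of the two signs does not shrink the image: the values at
      \<open>x + xi\<close> and \<open>x - xi\<close> differ by twice the value at
      \<open>xi\<close>.\<close>
    have "2 * norm (B n xi) = norm (B n (x + xi) - B n (x + (- xi)))"
      by (simp add: B.add B.diff flip: scaleR_2)
    also have "\<dots> \<le> norm (B n (x + xi)) + norm (B n (x + (- xi)))" by (rule norm_triangle_ineq4)
    finally have "norm (B n (x + xi)) \<ge> norm (B n xi) \<or> norm (B n (x + (- xi))) \<ge> norm (B n xi)"
      by linarith
    then show ?thesis using 1 nxi by (metis norm_minus_cancel order_trans order_refl)
  qed
  then obtain xi where xi: "\<And>n x. norm (xi n x) \<le> (1/3) ^ n"
    "\<And>n x. norm (B n (x + xi n x)) \<ge> 2/3 * (1/3) ^ n * K n" by metis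
  define X where "X = rec_nat 0 (\<lambda>n x. x + xi n x)"
  have X_Suc: "X (Suc n) = X n + xi n (X n)" for n by (simp add: X_def)
  define z where "z n = xi n (X n)" for n
  have X_sum: "X n = (\<Sum>m<n. z m)" for n
    by (induction n) (simp_all add: X_Suc z_def, simp add: X_def)
  have nz: "norm (z m) \<le> (1/3) ^ m" for m by (simp add: z_def xi)
  have geo: "summable (\<lambda>m. (1/3) ^ m :: real)" by (simp add: summable_geometric)
  have sumn: "summable (\<lambda>m. norm (z m))"
    by (rule summable_comparison_test'[OF geo]) (simp add: nz)
  have sumz: "summable z" by (rule summable_norm_cancel[OF sumn])
  define x where "x = suminf z"
  \<comment> \<open>The terms after \<open>z n\<close> sum to at most 1/2 of 3^(-n), while step n
    gained 2/3 of it. The difference 1/6 survives in the limit and is the constant below.\<close>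
  have tail: "norm (x - X (Suc n)) \<le> (1/3) ^ n / 2" for n
  proof -
    have "x - X (Suc n) = (\<Sum>m. z (m + Suc n))"
      using suminf_minus_initial_segment[OF sumz, of "Suc n"] by (simp add: x_def X_sum)
    also have "norm \<dots> \<le> (\<Sum>m. norm (z (m + Suc n)))"
      by (rule summable_norm[OF summable_ignore_initial_segment[OF sumn]])
    also have "\<dots> \<le> (\<Sum>m. (1/3) ^ (m + Suc n))"
      by (rule suminf_le[OF nz summable_ignore_initial_segment[OF sumn]
            summable_ignore_initial_segment[OF geo]])
    also have "\<dots> = (\<Sum>m. (1/3) ^ m * (1/3) ^ Suc n)" by (simp only: power_add)
    also have "\<dots> = (\<Sum>m. (1/3) ^ m) * (1/3) ^ Suc n"
      by (rule suminf_mult2[OF geo, symmetric])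
    also have "\<dots> = (1/3) ^ n / 2" by (simp add: suminf_geometric)
    finally show ?thesis .
  qed
  obtain C where C: "\<And>n. norm (A n x) \<le> C" using bdd[of x] by (auto simp: bounded_iff)
  have "(4/3) ^ n / 6 \<le> C" for n
  proof -
    interpret B: bounded_linear "B n" by (rule linB)
    have "2/3 * (1/3) ^ n * K n \<le> norm (B n (X (Suc n)))" using xi(2) by (simp add: X_Suc)
    also have "\<dots> = norm (B n x - B n (x - X (Suc n)))" by (simp add: B.diff)
    also have "\<dots> \<le> norm (B n x) + norm (B n (x - X (Suc n)))" by (rule norm_triangle_ineq4)
    also have "norm (B n (x - X (Suc n))) \<le> K n * norm (x - X (Suc n))"
      unfolding K_def by (rule onorm[OF linB])
    also have "\<dots> \<le> K n * ((1/3) ^ n / 2)" using tail K0[of n] by (intro mult_left_mono) auto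
    finally have "K n * (1/3) ^ n / 6 \<le> norm (B n x)" by (simp add: field_simps)
    moreover have "4 ^ n * (1/3) ^ n / 6 \<le> K n * (1/3) ^ n / 6"
      using K4[of n] by (intro divide_right_mono mult_right_mono) auto
    moreover have "norm (B n x) \<le> C" using C by (simp add: B_def)
    moreover have "(4/3) ^ n = 4 ^ n * (1/3 :: real) ^ n" by (simp flip: power_mult_distrib)
    ultimately show ?thesis by linarith
  qed
  then have "(4/3) ^ n \<le> 6 * C" for n by (simp add: field_simps)
  moreover obtain n where "6 * C < (4/3) ^ n" using real_arch_pow[of "4/3 :: real" "6 * C"] by auto
  ultimately show False by (meson not_less)
qed

lemma has_vector_derivative_iff_quotient:
  fixes f :: "real \<Rightarrow> 'a::real_normed_vector"
  shows "(f has_vector_derivative D) (at t within S) \<longleftrightarrow>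
    ((\<lambda>s. (f s - f t) /\<^sub>R (s - t)) \<longlongrightarrow> D) (at t within S)"
proof -
  have eq: "norm (f s - f t - (s - t) *\<^sub>R D) / norm (s - t) = norm ((f s - f t) /\<^sub>R (s - t) - D)"
    if "s \<noteq> t" for s
  proof -
    have "(f s - f t) /\<^sub>R (s - t) - D = (f s - f t - (s - t) *\<^sub>R D) /\<^sub>R (s - t)"
      using that by (simp add: scaleR_diff_right)
    then show ?thesis by (simp add: divide_inverse mult.commute)
  qed
  have "(f has_vector_derivative D) (at t within S) \<longleftrightarrow>
      ((\<lambda>s. norm (f s - f t - (s - t) *\<^sub>R D) / norm (s - t)) \<longlongrightarrow> 0) (at t within S)"
    unfolding has_vector_derivative_def has_derivative_iff_norm
    by (simp add: bounded_linear_scaleR_left)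
  also have "\<dots> \<longleftrightarrow> ((\<lambda>s. norm ((f s - f t) /\<^sub>R (s - t) - D)) \<longlongrightarrow> 0) (at t within S)"
    by (rule filterlim_cong[OF refl refl]) (simp add: eventually_at_filter eq del: real_norm_def)
  also have "\<dots> \<longleftrightarrow> ((\<lambda>s. (f s - f t) /\<^sub>R (s - t)) \<longlongrightarrow> D) (at t within S)"
    by (simp add: tendsto_norm_zero_iff LIM_zero_iff)
  finally show ?thesis .
qed

section \<open>Orbits and the generator of a strongly continuous semigroup\<close>

locale strongly_continuous_semigroup =
  fixes T :: "real \<Rightarrow> 'b::banach \<Rightarrow> 'b"
  assumes blin: "0 \<le> t \<Longrightarrow> bounded_linear (T t)"
    and zero: "T 0 x = x"
    and add: "0 \<le> s \<Longrightarrow> 0 \<le> t \<Longrightarrow> T (s + t) x = T s (T t x)"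
    and right_cont: "((\<lambda>t. T t x) \<longlongrightarrow> x) (at_right 0)"
begin

definition gen :: "('b \<times> 'b) set" where
  "gen = {(x, y). ((\<lambda>t. (T t x - x) /\<^sub>R t) \<longlongrightarrow> y) (at_right 0)}"

lemma tendsto_0: "((\<lambda>t. T t x) \<longlongrightarrow> x) (at 0 within {0..})"
  using right_cont by (simp add: at_within_Ici_at_right)

lemma tendsto_0_compose:
  assumes "(g \<longlongrightarrow> 0) F" "eventually (\<lambda>s. 0 \<le> g s) F"
  shows "((\<lambda>s. T (g s) x) \<longlongrightarrow> x) F"
proof -
  have "continuous (at 0 within {0..}) (\<lambda>t. T t x)"
    using tendsto_0[of x] by (simp add: continuous_within zero)
  moreover have "eventually (\<lambda>s. g s \<in> {0..}) F" using assms(2) by simp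
  ultimately have "((\<lambda>s. T (g s) x) \<longlongrightarrow> T 0 x) F"
    by (rule continuous_within_tendsto_compose[OF _ _ assms(1)])
  then show ?thesis unfolding zero .
qed

text \<open>Each operator has its own bound, with no uniformity in time. If uniformity failed near
  0, there would be times \<open>t n\<close> tending to 0 with unbounded operator norms, although
  every orbit converges along them; the uniform boundedness principle excludes this.\<close>

lemma bounded_near_0: "\<exists>d>0. \<exists>M. \<forall>t\<in>{0..d}. \<forall>x. norm (T t x) \<le> M * norm x"
proof (rule ccontr)
  assume neg: "\<not> ?thesis"
  have neg': "\<not> (\<forall>t\<in>{0..d}. \<forall>x. norm (T t x) \<le> M * norm x)" if "0 < d" for d M
    using neg that by meson
  have "\<exists>t x. 0 \<le> t \<and> t \<le> inverse (real (Suc n)) \<and> norm (T t x) > real n * norm x" for n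
  proof -
    have "0 < inverse (real (Suc n))" by simp
    from neg'[OF this, of "real n"] show ?thesis unfolding Ball_def not_all not_imp not_le atLeastAtMost_iff by (simp only: conj_assoc) blast
  qed
  then obtain t x where tx: "\<And>n. 0 \<le> t n" "\<And>n. t n \<le> inverse (real (Suc n))"
    "\<And>n. norm (T (t n) (x n)) > real n * norm (x n)" by metis
  have "t \<longlonglongrightarrow> 0"
    by (rule tendsto_sandwich[OF _ _ tendsto_const LIMSEQ_inverse_real_of_nat])
      (use tx in auto)
  then have "(\<lambda>n. T (t n) z) \<longlonglongrightarrow> z" for z
    by (rule tendsto_0_compose) (use tx in auto)
  then have "\<exists>M. \<forall>n z. norm (T (t n) z) \<le> M * norm z"
    by (intro banach_steinhaus_seq blin tx convergent_imp_bounded)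
  then obtain M where M: "\<And>n z. norm (T (t n) z) \<le> M * norm z" by blast
  obtain n where "M \<le> real n" using real_arch_simple by blast
  then have "norm (T (t n) (x n)) \<le> real n * norm (x n)"
    using M[of n "x n"] mult_right_mono[of M "real n" "norm (x n)"] by simp
  with tx(3)[of n] show False by simp
qed

lemma locally_bounded:
  "\<exists>M>0. \<forall>t\<in>{0..b}. \<forall>x. norm (T t x) \<le> M * norm x"
proof -
  obtain d M where d: "d > 0" and M: "\<And>t x. 0 \<le> t \<Longrightarrow> t \<le> d \<Longrightarrow> norm (T t x) \<le> M * norm x"
    using bounded_near_0 by (meson atLeastAtMost_iff)
  \<comment> \<open>A bound of at least 1 makes the powers of \<open>L\<close> increase, so that one
    power serves all times up to \<open>b\<close>.\<close>
  define L where "L = max M 1"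
  have L: "0 \<le> t \<Longrightarrow> t \<le> d \<Longrightarrow> norm (T t x) \<le> L * norm x" for t x
    using M[of t x] mult_right_mono[of M L "norm x"] by (simp add: L_def)
  have L1: "L \<ge> 1" by (simp add: L_def)
  have *: "norm (T t x) \<le> L ^ Suc n * norm x" if "0 \<le> t" "t \<le> real (Suc n) * d" for t x n
    using that
  proof (induction n arbitrary: t)
    case 0
    then show ?case using L by simp
  next
    case (Suc n)
    show ?case
    proof (cases "t \<le> d")
      case True
      then have "norm (T t x) \<le> L ^ 1 * norm x" using L Suc.prems by simp
      also have "\<dots> \<le> L ^ Suc (Suc n) * norm x"
        using L1 by (intro mult_right_mono power_increasing) auto
      finally show ?thesis .
    next
      case False
      have "norm (T t x) = norm (T d (T (t - d) x))" using add[of d "t - d" x] False d by simp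
      also have "\<dots> \<le> L * norm (T (t - d) x)" using L d by simp
      also have "\<dots> \<le> L * (L ^ Suc n * norm x)"
        using Suc.prems False L1 by (intro mult_left_mono Suc.IH) (auto simp: algebra_simps)
      finally show ?thesis by (simp add: mult_ac)
    qed
  qed
  obtain n where "b / d \<le> real n" using real_arch_simple by blast
  then have "b \<le> real (Suc n) * d" using d by (simp add: field_simps)
  then have "\<forall>t\<in>{0..b}. \<forall>x. norm (T t x) \<le> L ^ Suc n * norm x"
    using *[of _ n] by (meson atLeastAtMost_iff order_trans)
  moreover have "0 < L ^ Suc n" using L1 by simp
  ultimately show ?thesis by (intro exI[of _ "L ^ Suc n"] conjI)
qed

lemma orbit_tendsto:
  assumes "0 \<le> t"
  shows "((\<lambda>s. T s x) \<longlongrightarrow> T t x) (at t within {0..})"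
proof -
  obtain M where M: "0 < M" "\<And>s x. 0 \<le> s \<Longrightarrow> s \<le> t \<Longrightarrow> norm (T s x) \<le> M * norm x"
    using locally_bounded[of t] by (meson atLeastAtMost_iff)
  have le: "norm (T s x - T t x) \<le> M * norm (T \<bar>s - t\<bar> x - x)" if "0 \<le> s" for s
  proof -
    \<comment> \<open>Factoring out the operator at the smaller time treats both sides of
      \<open>t\<close> at once and keeps that time inside [0, t], where \<open>M\<close> is a
      bound.\<close>
    define a where "a = min s t"
    have a: "0 \<le> a" "a \<le> t" using that assms by (auto simp: a_def)
    interpret Ta: bounded_linear "T a" by (rule blin[OF a(1)])
    have "norm (T s x - T t x) = norm (T (a + \<bar>s - t\<bar>) x - T a x)"
      by (cases "s \<le> t") (auto simp: a_def norm_minus_commute)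
    also have "\<dots> = norm (T a (T \<bar>s - t\<bar> x - x))"
      using a by (simp add: add Ta.diff)
    also have "\<dots> \<le> M * norm (T \<bar>s - t\<bar> x - x)" using M(2) a by blast
    finally show ?thesis .
  qed
  have "((\<lambda>s. T \<bar>s - t\<bar> x) \<longlongrightarrow> x) (at t within {0..})"
    by (rule tendsto_0_compose) (auto intro!: tendsto_eq_intros)
  then have "((\<lambda>s. M * norm (T \<bar>s - t\<bar> x - x)) \<longlongrightarrow> 0) (at t within {0..})"
    by (auto intro!: tendsto_eq_intros)
  then have "((\<lambda>s. T s x - T t x) \<longlongrightarrow> 0) (at t within {0..})"
    by (rule Lim_null_comparison[rotated]) (auto simp: eventually_at_filter le)
  then show ?thesis by (simp add: LIM_zero_iff)
qed

lemma continuous_on_orbit: "continuous_on {0..} (\<lambda>s. T s x)"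
  unfolding continuous_on_def by (simp add: orbit_tendsto)

lemma gen_orbit:
  assumes "(x, y) \<in> gen" "0 \<le> t"
  shows "(T t x, T t y) \<in> gen"
proof -
  interpret Tt: bounded_linear "T t" by (rule blin[OF assms(2)])
  have "((\<lambda>h. T t ((T h x - x) /\<^sub>R h)) \<longlongrightarrow> T t y) (at_right 0)"
    using assms(1) by (intro Tt.tendsto) (simp add: gen_def)
  moreover have "eventually (\<lambda>h. T t ((T h x - x) /\<^sub>R h) = (T h (T t x) - T t x) /\<^sub>R h) (at_right 0)"
    unfolding eventually_at_filter
    using assms(2) by (intro always_eventually)
      (auto simp: Tt.scaleR Tt.diff add.commute[of t] simp flip: add)
  ultimately show ?thesis
    unfolding gen_def by (auto elim: Lim_transform_eventually)
qed

lemma gen_diff: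
  assumes "(x, y) \<in> gen" "(x', y') \<in> gen"
  shows "(x - x', y - y') \<in> gen"
proof -
  have "((\<lambda>h. (T h x - x) /\<^sub>R h - (T h x' - x') /\<^sub>R h) \<longlongrightarrow> y - y') (at_right 0)"
    using assms by (intro tendsto_diff) (auto simp: gen_def)
  moreover have "eventually (\<lambda>h. (T h x - x) /\<^sub>R h - (T h x' - x') /\<^sub>R h
      = (T h (x - x') - (x - x')) /\<^sub>R h) (at_right 0)"
    unfolding eventually_at_filter
    by (intro always_eventually)
      (auto simp: linear_diff[OF bounded_linear.linear[OF blin]] algebra_simps)
  ultimately show ?thesis unfolding gen_def by (auto elim: Lim_transform_eventually)
qed

lemma gen_scaleR:
  assumes "(x, y) \<in> gen"
  shows "(c *\<^sub>R x, c *\<^sub>R y) \<in> gen"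
proof -
  have "((\<lambda>h. c *\<^sub>R ((T h x - x) /\<^sub>R h)) \<longlongrightarrow> c *\<^sub>R y) (at_right 0)"
    using assms by (intro tendsto_intros) (auto simp: gen_def)
  moreover have "eventually (\<lambda>h. c *\<^sub>R ((T h x - x) /\<^sub>R h)
      = (T h (c *\<^sub>R x) - c *\<^sub>R x) /\<^sub>R h) (at_right 0)"
    unfolding eventually_at_filter
    by (intro always_eventually)
      (auto simp: linear_cmul[OF bounded_linear.linear[OF blin]] algebra_simps)
  ultimately show ?thesis unfolding gen_def by (auto elim: Lim_transform_eventually)
qed

text \<open>The generator yields right derivatives only. The left difference quotient is
  \<open>T s\<close> applied to the quotient at 0 for the step \<open>t - s\<close>; it converges by
  the local norm bound and the continuity of the orbit of \<open>y\<close>.\<close>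

lemma orbit_has_vector_derivative:
  assumes xy: "(x, y) \<in> gen" and t: "0 \<le> t"
  shows "((\<lambda>s. T s x) has_vector_derivative T t y) (at t within {0..})"
proof -
  obtain M where M: "0 < M" "\<And>s x. 0 \<le> s \<Longrightarrow> s \<le> t \<Longrightarrow> norm (T s x) \<le> M * norm x"
    using locally_bounded[of t] by (meson atLeastAtMost_iff)
  \<comment> \<open>The value \<open>y\<close> at 0 makes the difference quotient continuous there,
    so it may be composed with the distance of \<open>s\<close> to \<open>t\<close>.\<close>
  define q where "q d = (if d = 0 then y else (T d x - x) /\<^sub>R d)" for d
  have qlim: "(q \<longlongrightarrow> y) (at 0 within {0..})"
  proof -
    have "eventually (\<lambda>d. (T d x - x) /\<^sub>R d = q d) (at_right 0)"
      by (auto simp: eventually_at_filter q_def)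
    with xy show ?thesis
      unfolding gen_def at_within_Ici_at_right by (auto elim: Lim_transform_eventually)
  qed
  have le: "norm ((T s x - T t x) /\<^sub>R (s - t) - T t y)
      \<le> M * norm (q \<bar>s - t\<bar> - y) + norm (T (min s t) y - T t y)" if "0 \<le> s" "s \<noteq> t" for s
  proof -
    define a d where "a = min s t" and "d = \<bar>s - t\<bar>"
    have a: "0 \<le> a" "a \<le> t" and d: "d > 0" using that t by (auto simp: a_def d_def)
    interpret Ta: bounded_linear "T a" by (rule blin[OF a(1)])
    have "(T s x - T t x) /\<^sub>R (s - t) = (T (a + d) x - T a x) /\<^sub>R d"
    proof (cases "s \<le> t")
      case True
      then have "s = a" "t = a + d" "s - t = - d" by (auto simp: a_def d_def)
      then show ?thesis by (simp flip: scaleR_minus_right)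
    next
      case False
      then have "t = a" "s = a + d" "s - t = d" by (auto simp: a_def d_def)
      then show ?thesis by simp
    qed
    also have "\<dots> = T a (q d)" using a d by (simp add: q_def add Ta.scaleR Ta.diff)
    finally have "(T s x - T t x) /\<^sub>R (s - t) - T t y = T a (q d - y) + (T a y - T t y)"
      by (simp add: Ta.diff)
    also have "norm \<dots> \<le> norm (T a (q d - y)) + norm (T a y - T t y)" by (rule norm_triangle_ineq)
    also have "\<dots> \<le> M * norm (q d - y) + norm (T a y - T t y)" using M(2) a by simp
    finally show ?thesis by (simp add: a_def d_def)
  qed
  have "continuous (at 0 within {0..}) q" using qlim by (simp add: continuous_within q_def)
  then have "((\<lambda>s. q \<bar>s - t\<bar>) \<longlongrightarrow> q 0) (at t within {0..})"
    by (rule continuous_within_tendsto_compose) (auto intro!: tendsto_eq_intros)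
  then have 1: "((\<lambda>s. q \<bar>s - t\<bar>) \<longlongrightarrow> y) (at t within {0..})" by (simp add: q_def)
  have "continuous (at t within {0..}) (\<lambda>s. T s y)"
    using orbit_tendsto[OF t] by (simp add: continuous_within)
  then have 2: "((\<lambda>s. T (min s t) y) \<longlongrightarrow> T t y) (at t within {0..})"
    by (rule continuous_within_tendsto_compose)
      (use t in \<open>auto intro!: tendsto_eq_intros simp: eventually_at_filter\<close>)
  have "((\<lambda>s. M * norm (q \<bar>s - t\<bar> - y) + norm (T (min s t) y - T t y)) \<longlongrightarrow> 0) (at t within {0..})"
    using 1 2 by (auto intro!: tendsto_eq_intros)
  then have "((\<lambda>s. (T s x - T t x) /\<^sub>R (s - t) - T t y) \<longlongrightarrow> 0) (at t within {0..})"
    by (rule Lim_null_comparison[rotated]) (auto simp: eventually_at_filter le)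
  then show ?thesis
    by (simp add: has_vector_derivative_iff_quotient LIM_zero_iff)
qed

lemma integral_orbit_has_vector_derivative:
  assumes "0 \<le> t"
  shows "((\<lambda>s. integral {0..s} (\<lambda>r. T r x)) has_vector_derivative T t x) (at t within {0..})"
proof -
  have "((\<lambda>s. integral {0..s} (\<lambda>r. T r x)) has_vector_derivative T t x) (at t within {0..t+1})"
    using assms
    by (intro integral_has_vector_derivative continuous_on_subset[OF continuous_on_orbit]) auto
  moreover have "at t within {0..t+1} = at t within {0..}"
    by (rule at_within_nhd[of t "{..<t+1}"]) (use assms in auto)
  ultimately show ?thesis by simp
qed

lemma semigroup_integral_orbit:
  assumes h: "0 \<le> h" and t: "0 \<le> t"
  shows "T h (integral {0..t} (\<lambda>r. T r x))
       = integral {0..t+h} (\<lambda>r. T r x) - integral {0..h} (\<lambda>r. T r x)"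
proof -
  define I where "I s = integral {0..s} (\<lambda>r. T r x)" for s
  have "((\<lambda>s. I (s + h)) has_vector_derivative T (s + h) x) (at s within {0..t})" if "s \<in> {0..t}" for s
  proof -
    have "((\<lambda>s. s + h) has_vector_derivative 1) (at s within {0..t})"
      by (auto intro!: derivative_eq_intros)
    moreover have "(I has_vector_derivative T (s + h) x) (at (s + h) within (\<lambda>s. s + h) ` {0..t})"
      using integral_orbit_has_vector_derivative[of "s + h" x] that h
      by (auto simp: I_def[abs_def] intro: has_vector_derivative_within_subset)
    ultimately show ?thesis
      using vector_diff_chain_within[of "\<lambda>s. s + h" 1 s "{0..t}" I "T (s + h) x"]
      by (simp add: o_def)
  qed
  then have "((\<lambda>s. T (s + h) x) has_integral (I (t + h) - I (0 + h))) {0..t}"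
    by (rule fundamental_theorem_of_calculus[OF t])
  then have 1: "integral {0..t} (\<lambda>s. T (s + h) x) = I (t + h) - I h"
    by (simp add: integral_unique)
  have "(\<lambda>s. T s x) integrable_on {0..t}"
    by (intro integrable_continuous_real continuous_on_subset[OF continuous_on_orbit]) auto
  from integral_linear[OF this blin[OF h]]
  have "T h (I t) = integral {0..t} (\<lambda>s. T h (T s x))" by (simp add: I_def o_def)
  also have "\<dots> = integral {0..t} (\<lambda>s. T (s + h) x)"
    using h by (intro integral_cong) (simp add: add.commute[of _ h] add)
  finally show ?thesis using 1 by (simp add: I_def)
qed

text \<open>The source of elements of the domain: applying \<open>T h\<close> shifts the interval of
  integration, so only its two ends contribute to the difference quotient. Divided by
  \<open>t\<close>, these integrals tend to \<open>x\<close>, whence the domain is dense.\<close>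

lemma integral_orbit_gen:
  assumes t: "0 < t"
  shows "(integral {0..t} (\<lambda>r. T r x), T t x - x) \<in> gen"
proof -
  define I where "I s = integral {0..s} (\<lambda>r. T r x)" for s
  have D: "((\<lambda>h. (I (s + h) - I s) /\<^sub>R h) \<longlongrightarrow> T s x) (at_right 0)" if "0 \<le> s" for s
  proof -
    have "(I has_vector_derivative T s x) (at s within {s..})"
      using integral_orbit_has_vector_derivative[OF that, of x] that
      by (auto simp: I_def[abs_def] intro: has_vector_derivative_within_subset)
    then have "((\<lambda>r. (I r - I s) /\<^sub>R (r - s)) \<longlongrightarrow> T s x) (at_right s)"
      by (simp add: has_vector_derivative_iff_quotient at_within_Ici_at_right)
    then show ?thesis
      by (simp add: filterlim_at_right_to_0[of _ _ s] add.commute)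
  qed
  have I0: "I 0 = 0" by (simp add: I_def)
  have "((\<lambda>h. (I (t + h) - I t) /\<^sub>R h - (I (0 + h) - I 0) /\<^sub>R h) \<longlongrightarrow> T t x - T 0 x) (at_right 0)"
    using t by (intro tendsto_diff D) auto
  moreover have "eventually (\<lambda>h. (I (t + h) - I t) /\<^sub>R h - (I (0 + h) - I 0) /\<^sub>R h
      = (T h (I t) - I t) /\<^sub>R h) (at_right 0)"
    unfolding eventually_at_filter
    using t by (intro always_eventually)
      (auto simp: I_def semigroup_integral_orbit algebra_simps)
  ultimately show ?thesis
    unfolding gen_def by (auto simp: zero I_def elim: Lim_transform_eventually)
qed

lemma dense_domain: "x \<in> closure (fst ` gen)"
proof -
  define I where "I s = integral {0..s} (\<lambda>r. T r x)" for s
  have "(I has_vector_derivative T 0 x) (at 0 within {0..})"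
    using integral_orbit_has_vector_derivative[of 0 x] by (simp add: I_def[abs_def])
  then have lim: "((\<lambda>t. I t /\<^sub>R t) \<longlongrightarrow> x) (at_right 0)"
    by (simp add: has_vector_derivative_iff_quotient at_within_Ici_at_right zero I_def)
  have "I t /\<^sub>R t \<in> fst ` gen" if "0 < t" for t
    using gen_scaleR[OF integral_orbit_gen[OF that, of x], of "inverse t"]
    by (force simp: I_def)
  then have "eventually (\<lambda>t. I t /\<^sub>R t \<in> closure (fst ` gen)) (at_right 0)"
    unfolding eventually_at_filter by (intro always_eventually allI impI) (meson closure_subset greaterThan_iff subsetD)
  from Lim_in_closed_set[OF closed_closure this _ lim] show ?thesis by simp
qed

end

section \<open>Dissipativity along orbits and its consequences\<close>

text \<open>
  Backward Euler: \<open>w (s + h) - h z (s + h)\<close> differs from \<open>w s\<close> by \<open>o(h)\<close>, uniformly in \<open>s\<close>,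
  so \<open>N\<close> grows by \<open>o(h)\<close> at most on each step of a partition of \<open>[0, t]\<close>.
\<close>

lemma dissipative_orbit_le:
  fixes w z :: "real \<Rightarrow> 'b::real_normed_vector" and N :: "'b \<Rightarrow> real"
  assumes subadd: "\<And>x y. N (x + y) \<le> N x + N y" and le_norm: "\<And>x. N x \<le> norm x"
    and t: "0 \<le> t"
    and deriv: "\<And>s. s \<in> {0..t} \<Longrightarrow> (w has_vector_derivative z s) (at s within {0..t})"
    and cont: "continuous_on {0..t} z"
    and diss: "\<And>s h. s \<in> {0..t} \<Longrightarrow> 0 < h \<Longrightarrow> N (w s) \<le> N (w s - h *\<^sub>R z s)"
  shows "N (w t) \<le> N (w 0)"
proof (rule field_le_epsilon)
  fix e :: real assume e: "0 < e"
  \<comment> \<open>The error rate adds up to \<open>t * e'\<close> over [0, t]; the summand 1 only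
    keeps the denominator positive when \<open>t\<close> is 0.\<close>
  define e' where "e' = e / (t + 1)"
  have e': "0 < e'" "t * e' \<le> e" using e t by (auto simp: e'_def field_simps)
  have "uniformly_continuous_on {0..t} z"
    by (intro compact_uniformly_continuous cont) simp
  then obtain d where d: "d > 0" "\<And>r s. r \<in> {0..t} \<Longrightarrow> s \<in> {0..t} \<Longrightarrow> dist s r < d \<Longrightarrow> dist (z s) (z r) < e'"
    using e' unfolding uniformly_continuous_on_def by metis
  obtain m :: nat where "t / d < real m" using reals_Archimedean2 by blast
  moreover from this have m: "0 < m" using divide_nonneg_pos[OF t d(1)] by (cases m) auto
  ultimately have m: "0 < m" "t / real m < d" using d(1) by (auto simp: field_simps)
  define h where "h = t / real m"
  show "N (w t) \<le> N (w 0) + e"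
  proof (cases "t = 0")
    case False
    with t m have h: "0 < h" "h < d" "real m * h = t" by (auto simp: h_def)
    have "N (w (real k * h)) \<le> N (w 0) + real k * h * e'" if "k \<le> m" for k
      using that
    proof (induction k)
      case (Suc k)
      define s r where "s = real k * h" and "r = real (Suc k) * h"
      have "r \<le> t" using Suc.prems h mult_right_mono[of "real (Suc k)" "real m" h] by (simp add: r_def)
      then have sr: "0 \<le> s" "s \<le> r" "r \<le> t" "r - s = h"
        using h by (auto simp: r_def s_def algebra_simps)
      \<comment> \<open>The linearization uses the derivative at the right end point
        \<open>r\<close>. This makes the step implicit, and \<open>diss\<close> at time
        \<open>r\<close> bounds \<open>N (w r)\<close> by exactly this expression.\<close>
      have "norm (w r - w s - (r - s) *\<^sub>R z r) \<le> norm (r - s) * e'"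
      proof (rule vector_differentiable_bound_linearization[where S = "{s..r}"])
        show "(w has_vector_derivative z u) (at u within {s..r})" if "u \<in> {s..r}" for u
          using deriv[of u] that sr by (auto intro: has_vector_derivative_within_subset)
        show "norm (z u - z r) \<le> e'" if "u \<in> {s..r}" for u
          using d(2)[of r u] that sr h by (auto simp: dist_norm intro!: less_imp_le)
      qed (use sr in \<open>auto simp: closed_segment_eq_real_ivl\<close>)
      then have err: "norm (w r - h *\<^sub>R z r - w s) \<le> h * e'"
        using sr h by (simp add: algebra_simps)
      have "N (w r) \<le> N (w r - h *\<^sub>R z r)" using diss sr h by auto
      also have "\<dots> = N (w s + (w r - h *\<^sub>R z r - w s))" by simp
      also have "\<dots> \<le> N (w s) + N (w r - h *\<^sub>R z r - w s)" by (rule subadd)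
      also have "\<dots> \<le> N (w s) + h * e'" using err le_norm order_trans by auto
      also have "\<dots> \<le> N (w 0) + real k * h * e' + h * e'" using Suc by (simp add: s_def)
      finally show ?case by (simp add: r_def algebra_simps)
    qed simp
    from this[of m] h e' show ?thesis by simp
  qed (use e in simp)
qed

text \<open>\<open>N\<close> may see one sign only, so the growth estimate is run for
  \<open>w\<close> and for \<open>- w\<close>; this is why \<open>graph\<close> asks for
  both.\<close>

lemma eq_zero_if_dissipative_orbit:
  fixes w z :: "real \<Rightarrow> 'b::real_normed_vector" and N :: "'b \<Rightarrow> real"
  assumes subadd: "\<And>x y. N (x + y) \<le> N x + N y" and le_norm: "\<And>x. N x \<le> norm x"
    and definite: "\<And>x. N x \<le> 0 \<Longrightarrow> N (- x) \<le> 0 \<Longrightarrow> x = 0"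
    and t: "0 \<le> t"
    and deriv: "\<And>s. s \<in> {0..t} \<Longrightarrow> (w has_vector_derivative z s) (at s within {0..t})"
    and cont: "continuous_on {0..t} z"
    and graph: "\<And>s. s \<in> {0..t} \<Longrightarrow> (w s, z s) \<in> G \<and> (- w s, - z s) \<in> G"
    and diss: "\<And>x y h. (x, y) \<in> G \<Longrightarrow> 0 < h \<Longrightarrow> N x \<le> N (x - h *\<^sub>R y)"
    and w0: "w 0 = 0"
  shows "w t = 0"
proof (rule definite)
  have N0: "N 0 \<le> 0" using le_norm[of 0] by simp
  show "N (w t) \<le> 0"
    using dissipative_orbit_le[of N, OF subadd le_norm t deriv cont] graph diss w0 N0 by fastforce
  have "N (- w t) \<le> N (- w 0)"
  proof (rule dissipative_orbit_le[OF subadd le_norm t, where z = "\<lambda>s. - z s"])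
    show "N (- w s) \<le> N (- w s - h *\<^sub>R - z s)" if "s \<in> {0..t}" "0 < h" for s h
      using graph that by (intro diss) auto
  qed (auto intro!: has_vector_derivative_minus deriv continuous_on_minus cont)
  then show "N (- w t) \<le> 0" using w0 N0 by simp
qed

context strongly_continuous_semigroup
begin

text \<open>The growth estimate applies to orbits that start in the domain. Subadditivity and
  \<open>le_norm\<close> make \<open>N\<close> Lipschitz with constant 1, so the inequality passes
  to the closure of the domain, which is everything.\<close>

lemma dissipative_imp_contractive:
  fixes N :: "'b \<Rightarrow> real"
  assumes subadd: "\<And>x y. N (x + y) \<le> N x + N y" and le_norm: "\<And>x. N x \<le> norm x"
    and diss: "\<And>x y h. (x, y) \<in> gen \<Longrightarrow> 0 < h \<Longrightarrow> N x \<le> N (x - h *\<^sub>R y)"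
    and t: "0 \<le> t"
  shows "N (T t x) \<le> N x"
proof -
  interpret Tt: bounded_linear "T t" by (rule blin[OF t])
  have N_diff: "\<bar>N a - N b\<bar> \<le> norm (a - b)" for a b
    using subadd[of b "a - b"] subadd[of a "b - a"] le_norm[of "a - b"] le_norm[of "b - a"]
    by (simp add: norm_minus_commute)
  have N_cont: "continuous_on UNIV N"
    unfolding continuous_on_iff using N_diff by (auto simp: dist_norm intro: le_less_trans)
  have dom: "N (T t u) \<le> N u" if "(u, v) \<in> gen" for u v
  proof -
    have "N (T t u) \<le> N (T 0 u)"
    proof (rule dissipative_orbit_le[OF subadd le_norm t, where z = "\<lambda>s. T s v"])
      show "((\<lambda>s. T s u) has_vector_derivative T s v) (at s within {0..t})" if "s \<in> {0..t}" for s
        using orbit_has_vector_derivative[OF \<open>(u, v) \<in> gen\<close>, of s] that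
        by (auto intro: has_vector_derivative_within_subset)
      show "continuous_on {0..t} (\<lambda>s. T s v)"
        by (rule continuous_on_subset[OF continuous_on_orbit]) auto
      show "N (T s u) \<le> N (T s u - h *\<^sub>R T s v)" if "s \<in> {0..t}" "0 < h" for s h
        using gen_orbit[OF \<open>(u, v) \<in> gen\<close>, of s] that by (intro diss) auto
    qed
    then show ?thesis by (simp add: zero)
  qed
  have "closed {u. N (T t u) \<le> N u}"
    by (intro closed_Collect_le continuous_on_compose2[OF N_cont] continuous_intros Tt.continuous_on) auto
  moreover have "fst ` gen \<subseteq> {u. N (T t u) \<le> N u}" using dom by auto
  ultimately have "closure (fst ` gen) \<subseteq> {u. N (T t u) \<le> N u}" by (rule closure_minimal[rotated])
  then show ?thesis using dense_domain by blast
qed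

text \<open>The defect \<open>T s (U u) - U (T s u)\<close> starts at 0 and, since \<open>U\<close>
  preserves the generator, solves the evolution equation. Dissipativity leaves 0 as its only
  solution. Density and continuity remove the restriction to the domain.\<close>

lemma commutes_with_symmetry:
  fixes N :: "'b \<Rightarrow> real"
  assumes subadd: "\<And>x y. N (x + y) \<le> N x + N y" and le_norm: "\<And>x. N x \<le> norm x"
    and definite: "\<And>x. N x \<le> 0 \<Longrightarrow> N (- x) \<le> 0 \<Longrightarrow> x = 0"
    and diss: "\<And>x y h. (x, y) \<in> gen \<Longrightarrow> 0 < h \<Longrightarrow> N x \<le> N (x - h *\<^sub>R y)"
    and U: "bounded_linear U"
    and U_gen: "\<And>x y. (x, y) \<in> gen \<Longrightarrow> (U x, U y) \<in> gen"
    and t: "0 \<le> t"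
  shows "T t (U x) = U (T t x)"
proof -
  interpret Tt: bounded_linear "T t" by (rule blin[OF t])
  interpret U: bounded_linear U by (rule U)
  have dom: "T t (U u) = U (T t u)" if uv: "(u, v) \<in> gen" for u v
  proof -
    have Uuv: "(U u, U v) \<in> gen" by (rule U_gen[OF uv])
    have "T t (U u) - U (T t u) = 0"
    proof (rule eq_zero_if_dissipative_orbit[OF subadd le_norm definite t,
          where w = "\<lambda>s. T s (U u) - U (T s u)" and z = "\<lambda>s. T s (U v) - U (T s v)" and G = gen])
      show "((\<lambda>s. T s (U u) - U (T s u)) has_vector_derivative T s (U v) - U (T s v)) (at s within {0..t})"
        if "s \<in> {0..t}" for s
      proof -
        have "((\<lambda>s. T s (U u)) has_vector_derivative T s (U v)) (at s within {0..t})"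
          and "((\<lambda>s. T s u) has_vector_derivative T s v) (at s within {0..t})"
          using orbit_has_vector_derivative[OF Uuv, of s] orbit_has_vector_derivative[OF uv, of s] that
          by (auto intro: has_vector_derivative_within_subset)
        then show ?thesis by (intro has_vector_derivative_diff U.has_vector_derivative)
      qed
      show "continuous_on {0..t} (\<lambda>s. T s (U v) - U (T s v))"
        by (intro continuous_on_diff U.continuous_on continuous_on_subset[OF continuous_on_orbit]) auto
      fix s assume "s \<in> {0..t}"
      then have "(T s (U u), T s (U v)) \<in> gen" "(U (T s u), U (T s v)) \<in> gen"
        using gen_orbit[OF Uuv, of s] gen_orbit[OF uv, of s] U_gen by auto
      from gen_diff[OF this] gen_diff[OF this(2,1)]
      show "(T s (U u) - U (T s u), T s (U v) - U (T s v)) \<in> gen \<and>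
        (- (T s (U u) - U (T s u)), - (T s (U v) - U (T s v))) \<in> gen" by simp
    qed (auto simp: zero diss)
    then show ?thesis by simp
  qed
  have "closed {u. T t (U u) = U (T t u)}"
    by (intro closed_Collect_eq continuous_intros Tt.continuous_on U.continuous_on)
  moreover have "fst ` gen \<subseteq> {u. T t (U u) = U (T t u)}" using dom by auto
  ultimately have "closure (fst ` gen) \<subseteq> {u. T t (U u) = U (T t u)}" by (rule closure_minimal[rotated])
  then show ?thesis using dense_domain by blast
qed

end

section \<open>Functions vanishing at infinity\<close>

lemma C_zero_bounded:
  assumes "f \<in> C_zero"
  shows "bounded (range f)"
proof -
  have cont: "continuous_on UNIV f" and lim: "(f \<longlongrightarrow> 0) at_infinity"
    using assms by (auto simp: C_zero_def)
  obtain R where R: "\<And>x. R \<le> norm x \<Longrightarrow> \<bar>f x\<bar> < 1"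
    using tendstoD[OF lim, of 1] by (auto simp: eventually_at_infinity dist_norm)
  have "bounded (f ` cball 0 R)"
    by (intro compact_imp_bounded compact_continuous_image continuous_on_subset[OF cont]) auto
  moreover have "bounded (f ` {x. R \<le> norm x})"
    unfolding bounded_iff by (intro exI[of _ 1]) (use R in force)
  moreover have "range f = f ` cball 0 R \<union> f ` {x. R \<le> norm x}"
    by (auto simp flip: image_Un)
  ultimately show ?thesis by simp
qed

lemma abs_le_sup_norm:
  assumes "f \<in> C_zero"
  shows "\<bar>f p\<bar> \<le> sup_norm f"
proof -
  obtain B where "\<And>p. \<bar>f p\<bar> \<le> B" using C_zero_bounded[OF assms] by (auto simp: bounded_iff)
  then show ?thesis unfolding sup_norm_def by (intro cSUP_upper bdd_aboveI) auto
qed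

lemma sup_norm_le: "(\<And>p. \<bar>f p\<bar> \<le> B) \<Longrightarrow> sup_norm f \<le> B"
  unfolding sup_norm_def by (rule cSUP_least) auto

lemma C_zero_linear_combination:
  assumes "f \<in> C_zero" "g \<in> C_zero"
  shows "(\<lambda>p. a * f p + b * g p) \<in> C_zero"
  using assms by (auto simp: C_zero_def intro!: continuous_intros tendsto_eq_intros)

lemma C_zero_uniform_limit:
  assumes "F \<noteq> bot" "\<And>n. u n \<in> C_zero" "uniform_limit UNIV u f F"
  shows "f \<in> C_zero"
proof -
  have "continuous_on UNIV f"
    using assms by (intro uniform_limit_theorem[OF _ assms(3,1)]) (auto simp: C_zero_def)
  moreover have "(f \<longlongrightarrow> 0) at_infinity"
  proof (rule tendstoI)
    fix e :: real assume "0 < e"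
    then have "eventually (\<lambda>n. \<forall>x. dist (u n x) (f x) < e / 2) F"
      using uniform_limitD[OF assms(3), of "e/2"] by simp
    then obtain n where n: "\<And>x. dist (u n x) (f x) < e / 2"
      using eventually_happens'[OF assms(1)] by blast
    have "eventually (\<lambda>x. dist (u n x) 0 < e / 2) at_infinity"
      using assms(2)[of n] \<open>0 < e\<close> by (intro tendstoD) (auto simp: C_zero_def)
    then show "eventually (\<lambda>x. dist (f x) 0 < e) at_infinity"
      by eventually_elim (use n in \<open>metis dist_commute dist_triangle_half_r\<close>)
  qed
  ultimately show ?thesis by (simp add: C_zero_def)
qed

section \<open>The Banach space \<open>C_zero\<close>\<close>

text \<open>A type of its own turns the function space into a Banach space, in which orbits can be
  differentiated and integrated as vector-valued functions of time.\<close>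

typedef (overloaded) 'a c0 = "C_zero :: ('a::euclidean_space \<Rightarrow> real) set"
  morphisms c0_fun Abs_c0
  by (rule exI[of _ "\<lambda>_. 0"]) (auto simp: C_zero_def)

setup_lifting type_definition_c0

lemma c0_eqI: "(\<And>p. c0_fun x p = c0_fun y p) \<Longrightarrow> x = y"
  by (simp add: c0_fun_inject[symmetric] fun_eq_iff)

instantiation c0 :: (euclidean_space) real_vector
begin

lift_definition zero_c0 :: "'a c0" is "\<lambda>_. 0" by (auto simp: C_zero_def)
lift_definition plus_c0 :: "'a c0 \<Rightarrow> 'a c0 \<Rightarrow> 'a c0" is "\<lambda>f g p. f p + g p"
  by (auto simp: C_zero_def intro!: continuous_intros tendsto_eq_intros)
lift_definition minus_c0 :: "'a c0 \<Rightarrow> 'a c0 \<Rightarrow> 'a c0" is "\<lambda>f g p. f p - g p"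
  by (auto simp: C_zero_def intro!: continuous_intros tendsto_eq_intros)
lift_definition uminus_c0 :: "'a c0 \<Rightarrow> 'a c0" is "\<lambda>f p. - f p"
  by (auto simp: C_zero_def intro!: continuous_intros tendsto_eq_intros)
lift_definition scaleR_c0 :: "real \<Rightarrow> 'a c0 \<Rightarrow> 'a c0" is "\<lambda>c f p. c * f p"
  by (auto simp: C_zero_def intro!: continuous_intros tendsto_eq_intros)

instance
  by standard (transfer; simp add: fun_eq_iff algebra_simps)+

end

lemmas c0_fun_simps [simp] =
  zero_c0.rep_eq plus_c0.rep_eq minus_c0.rep_eq uminus_c0.rep_eq scaleR_c0.rep_eq

instantiation c0 :: (euclidean_space) real_normed_vector
begin

definition norm_c0 :: "'a c0 \<Rightarrow> real" where "norm_c0 x = sup_norm (c0_fun x)"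
definition dist_c0 :: "'a c0 \<Rightarrow> 'a c0 \<Rightarrow> real" where "dist_c0 x y = norm (x - y)"
definition sgn_c0 :: "'a c0 \<Rightarrow> 'a c0" where "sgn_c0 x = x /\<^sub>R norm x"
definition uniformity_c0 :: "('a c0 \<times> 'a c0) filter"
  where "uniformity_c0 = (INF e\<in>{0 <..}. principal {(x, y). dist x y < e})"
definition open_c0 :: "'a c0 set \<Rightarrow> bool"
  where "open_c0 S = (\<forall>x\<in>S. \<forall>\<^sub>F (x', y) in uniformity. x' = x \<longrightarrow> y \<in> S)"

instance
proof
  have le: "\<bar>c0_fun x p\<bar> \<le> norm x" for x :: "'a c0" and p
    unfolding norm_c0_def by (rule abs_le_sup_norm) (rule c0_fun)
  have norm_le: "norm x \<le> B" if "\<And>p. \<bar>c0_fun x p\<bar> \<le> B" for x :: "'a c0" and B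
    unfolding norm_c0_def by (rule sup_norm_le) (rule that)
  fix x y :: "'a c0" and a :: real
  have nonneg: "0 \<le> norm x" for x :: "'a c0" using le[of x] abs_ge_zero order_trans by blast
  show "(norm x = 0) = (x = 0)"
  proof
    assume "norm x = 0"
    then show "x = 0" using le[of x] by (intro c0_eqI) simp
  next
    assume "x = 0"
    then have "norm x \<le> 0" by (intro norm_le) simp
    with nonneg[of x] show "norm x = 0" by simp
  qed
  show "norm (x + y) \<le> norm x + norm y"
    by (rule norm_le) (use le in \<open>auto intro: order_trans[OF abs_triangle_ineq] add_mono\<close>)
  have scale: "norm (a *\<^sub>R x) \<le> \<bar>a\<bar> * norm x" for a and x :: "'a c0"
    by (rule norm_le) (use le in \<open>auto simp: abs_mult intro: mult_left_mono\<close>)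
  show "norm (a *\<^sub>R x) = \<bar>a\<bar> * norm x"
  proof (cases "a = 0")
    case True
    then show ?thesis using scale[of a x] nonneg[of "a *\<^sub>R x"] by simp
  next
    case False
    have "norm (inverse a *\<^sub>R a *\<^sub>R x) \<le> \<bar>inverse a\<bar> * norm (a *\<^sub>R x)" by (rule scale)
    then have "\<bar>a\<bar> * norm x \<le> norm (a *\<^sub>R x)" using False by (simp add: field_simps)
    with scale[of a x] show ?thesis by simp
  qed
qed (rule dist_c0_def sgn_c0_def uniformity_c0_def open_c0_def)+

end

lemma abs_c0_fun_le_norm: "\<bar>c0_fun x p\<bar> \<le> norm x"
  unfolding norm_c0_def by (rule abs_le_sup_norm) (rule c0_fun)

lemma c0_norm_le: "(\<And>p. \<bar>c0_fun x p\<bar> \<le> B) \<Longrightarrow> norm x \<le> B"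
  unfolding norm_c0_def by (rule sup_norm_le)

lemma c0_tendsto_iff_uniform_limit:
  "(X \<longlongrightarrow> x) F \<longleftrightarrow> uniform_limit UNIV (\<lambda>n. c0_fun (X n)) (c0_fun x) F"
proof
  assume L: "(X \<longlongrightarrow> x) F"
  show "uniform_limit UNIV (\<lambda>n. c0_fun (X n)) (c0_fun x) F"
  proof (rule uniform_limitI)
    fix e :: real assume "0 < e"
    from tendstoD[OF L this]
    show "eventually (\<lambda>n. \<forall>p\<in>UNIV. dist (c0_fun (X n) p) (c0_fun x p) < e) F"
    proof eventually_elim
      case (elim n)
      then show ?case
        using abs_c0_fun_le_norm[of "X n - x"] by (auto simp: dist_norm intro: le_less_trans)
    qed
  qed
next
  assume L: "uniform_limit UNIV (\<lambda>n. c0_fun (X n)) (c0_fun x) F"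
  show "(X \<longlongrightarrow> x) F"
  proof (rule tendstoI)
    fix e :: real assume e: "0 < e"
    then have "eventually (\<lambda>n. \<forall>p. dist (c0_fun (X n) p) (c0_fun x p) < e / 2) F"
      using uniform_limitD[OF L, of "e/2"] by simp
    then show "eventually (\<lambda>n. dist (X n) x < e) F"
    proof eventually_elim
      case (elim n)
      then have "norm (X n - x) \<le> e / 2"
        by (intro c0_norm_le) (auto simp: dist_norm intro: less_imp_le)
      with e show ?case by (simp add: dist_norm)
    qed
  qed
qed

instance c0 :: (euclidean_space) banach
proof
  fix X :: "nat \<Rightarrow> 'a c0" assume "Cauchy X"
  have "uniformly_Cauchy_on UNIV (\<lambda>n. c0_fun (X n))"
  proof (rule uniformly_Cauchy_onI)
    fix e :: real assume "0 < e"
    then obtain M where M: "\<And>m n. m \<ge> M \<Longrightarrow> n \<ge> M \<Longrightarrow> dist (X m) (X n) < e"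
      using \<open>Cauchy X\<close> unfolding Cauchy_def by metis
    have "dist (c0_fun (X m) p) (c0_fun (X n) p) < e" if "m \<ge> M" "n \<ge> M" for m n p
      using abs_c0_fun_le_norm[of "X m - X n" p] M[OF that] by (simp add: dist_norm)
    then show "\<exists>M. \<forall>x\<in>UNIV. \<forall>m\<ge>M. \<forall>n\<ge>M. dist (c0_fun (X m) x) (c0_fun (X n) x) < e" by blast
  qed
  then obtain f where f: "uniform_limit UNIV (\<lambda>n. c0_fun (X n)) f sequentially"
    using Cauchy_uniformly_convergent unfolding uniformly_convergent_on_def by blast
  then have "f \<in> C_zero" by (intro C_zero_uniform_limit[OF _ c0_fun]) auto
  with f have "X \<longlonglongrightarrow> Abs_c0 f" by (simp add: c0_tendsto_iff_uniform_limit Abs_c0_inverse)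
  then show "convergent X" by (rule convergentI)
qed

text \<open>
  For this half-norm, dissipativity is the positive maximum principle and contractivity of a
  semigroup is positivity together with contractivity for the norm.
\<close>

definition pos_sup :: "'a::euclidean_space c0 \<Rightarrow> real" where
  "pos_sup x = (SUP p. max 0 (c0_fun x p))"

lemma pos_sup_upper: "max 0 (c0_fun x p) \<le> pos_sup x"
proof -
  have "max 0 (c0_fun x q) \<le> norm x" for q
    using abs_c0_fun_le_norm[of x q] norm_ge_zero[of x] by linarith
  then show ?thesis unfolding pos_sup_def by (intro cSUP_upper bdd_aboveI[of _ "norm x"]) (auto simp del: max.bounded_iff)
qed

lemma pos_sup_le: "0 \<le> B \<Longrightarrow> (\<And>p. c0_fun x p \<le> B) \<Longrightarrow> pos_sup x \<le> B"
  unfolding pos_sup_def by (rule cSUP_least) auto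

lemma pos_sup_nonneg: "0 \<le> pos_sup x" and c0_fun_le_pos_sup: "c0_fun x p \<le> pos_sup x"
  using pos_sup_upper[of x p] by auto

lemma pos_sup_add: "pos_sup (x + y) \<le> pos_sup x + pos_sup y"
  by (rule pos_sup_le) (auto intro: add_mono add_nonneg_nonneg pos_sup_nonneg c0_fun_le_pos_sup)

lemma pos_sup_le_norm: "pos_sup x \<le> norm x"
  by (rule pos_sup_le) (auto intro: order_trans[OF abs_ge_self abs_c0_fun_le_norm])

lemma pos_sup_definite: "pos_sup x \<le> 0 \<Longrightarrow> pos_sup (- x) \<le> 0 \<Longrightarrow> x = 0"
proof (rule c0_eqI)
  fix p
  assume "pos_sup x \<le> 0" "pos_sup (- x) \<le> 0"
  with c0_fun_le_pos_sup[of x p] c0_fun_le_pos_sup[of "- x" p]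
  show "c0_fun x p = c0_fun 0 p" by simp
qed

section \<open>From \<open>C0_semigroup\<close> to operators on \<open>c0\<close>\<close>

text \<open>Meaningful when \<open>Q\<close> maps \<open>C_zero\<close> to itself, which
  \<open>C0_semigroup\<close> grants for \<open>P t\<close> with nonnegative \<open>t\<close>;
  otherwise the value of \<open>Abs_c0\<close> is unspecified.\<close>

definition c0_op :: "(('a::euclidean_space \<Rightarrow> real) \<Rightarrow> ('a \<Rightarrow> real)) \<Rightarrow> 'a c0 \<Rightarrow> 'a c0" where
  "c0_op Q x = Abs_c0 (Q (c0_fun x))"

context
  fixes P :: "real \<Rightarrow> ('a::euclidean_space \<Rightarrow> real) \<Rightarrow> ('a \<Rightarrow> real)"
  assumes P: "C0_semigroup P"
begin

lemma C0_semigroup_C_zero: "0 \<le> t \<Longrightarrow> f \<in> C_zero \<Longrightarrow> P t f \<in> C_zero"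
  using P by (simp add: C0_semigroup_def)

lemma C0_semigroup_linear:
  "0 \<le> t \<Longrightarrow> f \<in> C_zero \<Longrightarrow> g \<in> C_zero \<Longrightarrow>
    P t (\<lambda>p. a * f p + b * g p) = (\<lambda>p. a * P t f p + b * P t g p)"
  using P by (simp add: C0_semigroup_def)

lemma c0_fun_c0_op: "0 \<le> t \<Longrightarrow> c0_fun (c0_op (P t) x) = P t (c0_fun x)"
  unfolding c0_op_def by (intro Abs_c0_inverse C0_semigroup_C_zero c0_fun)

lemma strongly_continuous_semigroup_c0_op: "strongly_continuous_semigroup (\<lambda>t. c0_op (P t))"
proof (rule strongly_continuous_semigroup.intro)
  fix s t :: real and x :: "'a c0"
  show "bounded_linear (c0_op (P t))" if t: "0 \<le> t"
  proof -
    obtain K where K: "\<And>f. f \<in> C_zero \<Longrightarrow> sup_norm (P t f) \<le> K * sup_norm f"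
      using P t unfolding C0_semigroup_def by meson
    note lin = C0_semigroup_linear[OF t c0_fun c0_fun]
    show ?thesis
    proof (rule bounded_linear_intro)
      show "c0_op (P t) (x + y) = c0_op (P t) x + c0_op (P t) y" for x y
        using lin[of 1 x 1 y] by (intro c0_eqI) (simp add: c0_fun_c0_op[OF t])
      show "c0_op (P t) (r *\<^sub>R x) = r *\<^sub>R c0_op (P t) x" for r x
        using lin[of r x 0 x] by (intro c0_eqI) (simp add: c0_fun_c0_op[OF t])
      show "norm (c0_op (P t) x) \<le> norm x * K" for x
        using K[OF c0_fun, of x] by (simp add: norm_c0_def c0_fun_c0_op[OF t] mult.commute)
    qed
  qed
  show "c0_op (P 0) x = x"
    using P by (intro c0_eqI) (simp add: c0_fun_c0_op C0_semigroup_def c0_fun)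
  show "c0_op (P (s + t)) x = c0_op (P s) (c0_op (P t) x)" if "0 \<le> s" "0 \<le> t"
    using P that by (intro c0_eqI) (simp add: c0_fun_c0_op C0_semigroup_def c0_fun)
  have ev: "eventually (\<lambda>t. \<forall>p\<in>UNIV. P t (c0_fun x) p = c0_fun (c0_op (P t) x) p) (at_right 0)"
    by (auto simp: eventually_at_filter c0_fun_c0_op)
  have "uniform_limit UNIV (\<lambda>t. P t (c0_fun x)) (c0_fun x) (at_right 0) \<longleftrightarrow>
      uniform_limit UNIV (\<lambda>t. c0_fun (c0_op (P t) x)) (c0_fun x) (at_right 0)"
    by (rule uniform_limit_cong[OF ev]) simp
  then show "((\<lambda>t. c0_op (P t) x) \<longlongrightarrow> x) (at_right 0)"
    using P c0_fun[of x] by (simp add: c0_tendsto_iff_uniform_limit C0_semigroup_def)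
qed

interpretation S: strongly_continuous_semigroup "\<lambda>t. c0_op (P t)"
  by (rule strongly_continuous_semigroup_c0_op)

lemma gen_c0_op_iff: "(x, y) \<in> S.gen \<longleftrightarrow> (c0_fun x, c0_fun y) \<in> generator P"
proof -
  have ev: "eventually (\<lambda>t. \<forall>p\<in>UNIV. (P t (c0_fun x) p - c0_fun x p) / t
      = c0_fun ((c0_op (P t) x - x) /\<^sub>R t) p) (at_right 0)"
    by (auto simp: eventually_at_filter c0_fun_c0_op divide_inverse mult.commute)
  have "uniform_limit UNIV (\<lambda>t p. (P t (c0_fun x) p - c0_fun x p) / t) (c0_fun y) (at_right 0) \<longleftrightarrow>
      uniform_limit UNIV (\<lambda>t. c0_fun ((c0_op (P t) x - x) /\<^sub>R t)) (c0_fun y) (at_right 0)"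
    by (rule uniform_limit_cong[OF ev]) simp
  then show ?thesis
    by (simp only: S.gen_def generator_def c0_tendsto_iff_uniform_limit c0_fun mem_Collect_eq
        case_prod_conv simp_thms)
qed

end

declare split_paired_All [simp del] split_paired_Ex [simp del]

section \<open>\<open>C\<^sup>k\<close> functions\<close>

lemma Ck_2_differentiable: "Ck 2 f \<Longrightarrow> f differentiable (at p)"
  and Ck_2_frechet_derivative_differentiable:
    "Ck 2 f \<Longrightarrow> (\<lambda>q. frechet_derivative f (at q) v) differentiable (at p)"
  by (simp_all add: numeral_2_eq_2)

lemma has_frechet_derivative:
  "f differentiable (at p) \<Longrightarrow> (f has_derivative frechet_derivative f (at p)) (at p)"
  by (simp add: frechet_derivative_works)

lemma frechet_derivative_eqI:
  "(f has_derivative f') (at p) \<Longrightarrow> frechet_derivative f (at p) = f'"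
  by (rule frechet_derivative_at[symmetric])

text \<open>\<open>Ck\<close> speaks of derivatives in fixed directions. The expansion over the
  basis reaches directions that vary with the point, as those of a vector field do.\<close>

lemma frechet_derivative_expand:
  fixes f :: "'a::euclidean_space \<Rightarrow> real"
  assumes "f differentiable (at p)"
  shows "frechet_derivative f (at p) v = (\<Sum>b\<in>Basis. (v \<bullet> b) * frechet_derivative f (at p) b)"
proof -
  have "frechet_derivative f (at p) (\<Sum>b\<in>Basis. (v \<bullet> b) *\<^sub>R b)
      = (\<Sum>b\<in>Basis. (v \<bullet> b) * frechet_derivative f (at p) b)"
    by (simp add: linear_sum[OF linear_frechet_derivative[OF assms]]
        linear_cmul[OF linear_frechet_derivative[OF assms]])
  then show ?thesis by (simp add: euclidean_representation)
qed

lemma Ck_imp_continuous: "Ck k f \<Longrightarrow> continuous_on UNIV f"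
  by (cases k) (auto intro!: differentiable_imp_continuous_on differentiable_at_withinI
      simp: differentiable_on_def)

lemma frechet_derivative_affine_compose:
  assumes L: "bounded_linear L" and phi: "\<And>p. phi p = c + L p"
    and f: "f differentiable (at (phi p))"
  shows "((\<lambda>q. f (phi q)) has_derivative (\<lambda>v. frechet_derivative f (at (phi p)) (L v))) (at p)"
proof -
  have "(phi has_derivative L) (at p)"
    unfolding phi[abs_def] by (auto intro!: derivative_eq_intros bounded_linear_imp_has_derivative[OF L])
  from has_derivative_compose[OF this has_frechet_derivative[OF f]] show ?thesis .
qed

text \<open>The derivative \<open>L\<close> of \<open>phi\<close> is constant, so a directional
  derivative of the composite is again a composite with \<open>phi\<close>, of the derivative of
  \<open>f\<close> in the fixed direction \<open>L v\<close>. This closes the induction without a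
  product rule.\<close>

lemma Ck_affine_compose:
  fixes f :: "'b::euclidean_space \<Rightarrow> real" and phi :: "'a::euclidean_space \<Rightarrow> 'b"
  assumes L: "bounded_linear L" and phi: "\<And>p. phi p = c + L p"
  shows "Ck k f \<Longrightarrow> Ck k (\<lambda>p. f (phi p))"
proof (induction k arbitrary: f)
  case 0
  have "continuous_on UNIV phi" unfolding phi[abs_def]
    by (intro continuous_intros bounded_linear.continuous_on[OF L])
  with 0 show ?case by (auto intro: continuous_on_compose2)
next
  case (Suc k)
  then have f: "f differentiable (at p)" for p by simp
  have der: "((\<lambda>q. f (phi q)) has_derivative (\<lambda>v. frechet_derivative f (at (phi p)) (L v))) (at p)" for p
    by (rule frechet_derivative_affine_compose[OF L phi f])
  then have "frechet_derivative (\<lambda>q. f (phi q)) (at p) = (\<lambda>v. frechet_derivative f (at (phi p)) (L v))" for p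
    by (rule frechet_derivative_eqI)
  moreover have "Ck k (\<lambda>p. frechet_derivative f (at (phi p)) (L v))" for v
    using Suc.IH[of "\<lambda>p. frechet_derivative f (at p) (L v)"] Suc.prems by simp
  ultimately show ?case using der by (auto simp: differentiable_def)
qed

section \<open>The left invariant fields\<close>

text \<open>The cocycle of the group law: the second layer of a product is y + y' +
  \<open>area x x'\<close>.\<close>

definition area :: "(real, 'n::{card2,linorder}) vec \<Rightarrow> (real, 'n) vec \<Rightarrow> (real, 'n ordpair) vec" where
  "area x x' = (\<chi> c. case Rep_ordpair c of (i, j) \<Rightarrow> (x $ i * x' $ j - x $ j * x' $ i) / 2)"

lemma area_nth: "i < j \<Longrightarrow> area x x' $ Abs_ordpair (i, j) = (x $ i * x' $ j - x $ j * x' $ i) / 2"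
  by (simp add: area_def Abs_ordpair_inverse)

lemma ordpair_vec_eqI:
  fixes y z :: "(real, 'n::{card2,linorder} ordpair) vec"
  assumes "\<And>i j. i < j \<Longrightarrow> y $ Abs_ordpair (i, j) = z $ Abs_ordpair (i, j)"
  shows "y = z"
proof (rule vec_eq_iff[THEN iffD2], rule allI)
  fix c :: "'n ordpair"
  obtain i j where ij: "Rep_ordpair c = (i, j)" by (cases "Rep_ordpair c")
  then have "i < j" using Rep_ordpair[of c] by simp
  with assms[OF this] ij show "y $ c = z $ c" by (metis Rep_ordpair_inverse)
qed

lemma bounded_bilinear_area: "bounded_bilinear (area :: (real, 'n::{card2,linorder}) vec \<Rightarrow> _)"
proof -
  have "bilinear (area :: (real, 'n) vec \<Rightarrow> _)"
    unfolding bilinear_def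
    by (intro conjI allI linearI)
      (rule ordpair_vec_eqI, simp add: area_nth field_simps)+
  then show ?thesis by (simp add: bilinear_conv_bounded_bilinear)
qed

interpretation area: bounded_bilinear "area :: (real, 'n::{card2,linorder}) vec \<Rightarrow> _"
  by (rule bounded_bilinear_area)

lemma area_self [simp]: "area x x = 0"
  by (rule ordpair_vec_eqI) (simp add: area_nth)

lemma area_commute: "area x x' = - area x' x"
  by (rule ordpair_vec_eqI) (simp add: area_nth field_simps)

text \<open>The antisymmetric family extending \<open>\<partial>/\<partial>y\<^sub>i\<^sub>j\<close> to all pairs of indices.\<close>

definition ybasis :: "'n::{card2,linorder} \<Rightarrow> 'n \<Rightarrow> (real, 'n ordpair) vec" where
  "ybasis i j = 2 *\<^sub>R area (axis i 1) (axis j 1)"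

lemma ybasis_nth:
  "k < l \<Longrightarrow> ybasis i j $ Abs_ordpair (k, l)
    = (if i = k \<and> j = l then 1 else 0) - (if i = l \<and> j = k then 1 else 0)"
  by (simp add: ybasis_def area_nth axis_def of_bool_def[symmetric] of_bool_conj eq_commute mult.commute)

lemma ybasis_less:
  assumes "i < j"
  shows "ybasis i j = axis (Abs_ordpair (i, j)) 1"
proof (rule ordpair_vec_eqI)
  fix k l :: 'a assume kl: "k < l"
  have "Abs_ordpair (k, l) = Abs_ordpair (i, j) \<longleftrightarrow> k = i \<and> l = j"
    using kl assms by (subst Abs_ordpair_inject) simp_all
  moreover have "\<not> (i = l \<and> j = k)" using kl assms by (meson less_asym)
  ultimately show "ybasis i j $ Abs_ordpair (k, l) = axis (Abs_ordpair (i, j)) 1 $ Abs_ordpair (k, l)"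
    unfolding ybasis_nth[OF kl] axis_def by (simp add: eq_commute[of k] eq_commute[of l])
qed

lemma ybasis_self [simp]: "ybasis i i = 0"
  by (simp add: ybasis_def)

lemma ybasis_commute: "ybasis i j = - ybasis j i"
  by (simp add: ybasis_def area_commute[of "axis i 1"])

lemma axis_expand: "x = (\<Sum>i\<in>UNIV. x $ i *\<^sub>R axis i (1::real))"
  by (simp add: vec_eq_iff axis_def if_distrib cong: if_cong)

lemma area_axis: "area x (axis i 1) = (1/2) *\<^sub>R (\<Sum>k\<in>UNIV. x $ k *\<^sub>R ybasis k i)"
proof -
  have "area x (axis i 1) = area (\<Sum>k\<in>UNIV. x $ k *\<^sub>R axis k 1) (axis i 1)"
    using axis_expand[of x] by simp
  also have "\<dots> = (\<Sum>k\<in>UNIV. x $ k *\<^sub>R area (axis k 1) (axis i 1))"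
    by (simp add: area.sum_left area.scaleR_left)
  finally show ?thesis by (simp add: ybasis_def scaleR_sum_right)
qed

text \<open>The velocity at s = 0 of \<open>p\<close> multiplied on the right by (s e_i, 0).\<close>

definition lfield :: "'n::{card2,linorder} \<Rightarrow> 'n nil2 \<Rightarrow> 'n nil2" where
  "lfield i p = (axis i 1, area (fst p) (axis i 1))"

lemma sum_UNIV_split:
  fixes i :: "'n::{finite,linorder}" and g :: "'n \<Rightarrow> 'a::comm_monoid_add"
  shows "(\<Sum>k\<in>UNIV. g k) = (\<Sum>k\<in>{..<i}. g k) + g i + (\<Sum>k\<in>{i<..}. g k)"
proof -
  have "UNIV = ({..<i} \<union> {i}) \<union> {i<..}" by auto
  also have "(\<Sum>k\<in>\<dots>. g k) = (\<Sum>k\<in>{..<i} \<union> {i}. g k) + (\<Sum>k\<in>{i<..}. g k)"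
    by (rule sum.union_disjoint) auto
  also have "(\<Sum>k\<in>{..<i} \<union> {i}. g k) = (\<Sum>k\<in>{..<i}. g k) + g i"
    by (subst sum.union_disjoint) auto
  finally show ?thesis .
qed

lemma dy_less: "i < j \<Longrightarrow> dy i j f p = frechet_derivative f (at p) (0, ybasis i j)"
  by (simp add: dy_def ybasis_less)

lemma dy_greater:
  assumes "f differentiable (at p)" "j < i"
  shows "dy j i f p = - frechet_derivative f (at p) (0, ybasis i j)"
  using linear_neg[OF linear_frechet_derivative[OF assms(1)], of "(0, ybasis i j)"]
  by (simp add: dy_less[OF assms(2)] ybasis_commute[of j i])

text \<open>With the antisymmetric \<open>ybasis\<close> the two ordered sums of opposite sign merge
  into one sum over all indices, whose diagonal term vanishes.\<close>

lemma Xf_eq: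
  assumes f: "f differentiable (at p)"
  shows "Xf i f p = frechet_derivative f (at p) (lfield i p)"
proof -
  interpret D: linear "frechet_derivative f (at p)" by (rule linear_frechet_derivative[OF f])
  let ?D = "frechet_derivative f (at p)"
  have "lfield i p = (axis i 1, 0) + (1/2) *\<^sub>R (\<Sum>k\<in>UNIV. xc k p *\<^sub>R (0, ybasis k i))"
    by (simp add: lfield_def area_axis xc_def prod_eq_iff fst_sum snd_sum)
  then have "?D (lfield i p) = ?D (axis i 1, 0) + 1/2 * (\<Sum>k\<in>UNIV. xc k p * ?D (0, ybasis k i))"
    by (simp add: D.add D.scaleR D.sum del: scaleR_Pair)
  also have "(\<Sum>k\<in>UNIV. xc k p * ?D (0, ybasis k i))
      = (\<Sum>k\<in>{..<i}. xc k p * dy k i f p) - (\<Sum>k\<in>{i<..}. xc k p * dy i k f p)"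
  proof -
    have "(\<Sum>k\<in>{..<i}. xc k p * ?D (0, ybasis k i)) = (\<Sum>k\<in>{..<i}. xc k p * dy k i f p)"
      by (simp add: dy_less)
    moreover have "(\<Sum>k\<in>{i<..}. xc k p * ?D (0, ybasis k i)) = - (\<Sum>k\<in>{i<..}. xc k p * dy i k f p)"
      by (simp add: dy_greater[OF f] flip: sum_negf)
    moreover have "?D (0, ybasis i i) = 0" using D.zero by (simp add: zero_prod_def)
    ultimately show ?thesis by (simp add: sum_UNIV_split[of _ i])
  qed
  finally show ?thesis by (simp add: Xf_def dx_def)
qed

lemma lfield_has_derivative: "(lfield i has_derivative (\<lambda>v. (0, area (fst v) (axis i 1)))) (at p)"
proof -
  have "bounded_linear (\<lambda>v::'a nil2. area (fst v) (axis i 1))"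
    by (rule bounded_linear_compose[OF area.bounded_linear_left bounded_linear_fst])
  then show ?thesis
    unfolding lfield_def[abs_def]
    by (intro has_derivative_Pair has_derivative_const bounded_linear_imp_has_derivative)
qed

lemma Xf_differentiable:
  assumes "Ck 2 f"
  shows "Xf i f differentiable (at p)"
proof -
  note f = Ck_2_differentiable[OF assms] and Df = Ck_2_frechet_derivative_differentiable[OF assms]
  have "Xf i f = (\<lambda>q. \<Sum>b\<in>Basis. (lfield i q \<bullet> b) * frechet_derivative f (at q) b)"
    by (rule ext) (simp only: Xf_eq[OF f] frechet_derivative_expand[OF f, of _ "lfield i _"])
  moreover have "lfield i differentiable (at p)"
    by (rule differentiableI[OF lfield_has_derivative])
  ultimately show ?thesis
    by (simp only:) (intro differentiable_sum differentiable_mult differentiable_inner Df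
        differentiable_const finite_Basis ballI)
qed

section \<open>The positive maximum principle for the sub-Laplacian\<close>

lemma XfXf_nonpos_at_max:
  assumes f: "Ck 2 f" and max: "\<And>q. f q \<le> f p"
  shows "Xf i (Xf i f) p \<le> 0"
proof (rule ccontr)
  assume neg: "\<not> ?thesis"
  note fd = Ck_2_differentiable[OF f]
  define v where "v = lfield i p"
  \<comment> \<open>The area of e_i with itself is 0, so the field is constant along this straight
    line. The line is therefore an integral curve, and the second application of X_i becomes an
    ordinary second derivative.\<close>
  have lv: "lfield i (p + s *\<^sub>R v) = v" for s
    by (simp add: v_def lfield_def area.add_left area.scaleR_left)
  define h where "h s = f (p + s *\<^sub>R v)" for s
  have line: "((\<lambda>s. p + s *\<^sub>R v) has_derivative (\<lambda>s. s *\<^sub>R v)) (at s)" for s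
    by (auto intro!: derivative_eq_intros)
  have h': "(h has_real_derivative Xf i f (p + s *\<^sub>R v)) (at s)" for s
  proof -
    have "(h has_derivative (\<lambda>r. frechet_derivative f (at (p + s *\<^sub>R v)) (r *\<^sub>R v))) (at s)"
      unfolding h_def[abs_def] by (rule has_derivative_compose[OF line has_frechet_derivative[OF fd]])
    then show ?thesis
      by (simp add: has_field_derivative_def Xf_eq[OF fd] lv linear_cmul[OF linear_frechet_derivative[OF fd]]
          mult_commute_abs)
  qed
  have h'': "((\<lambda>s. Xf i f (p + s *\<^sub>R v)) has_real_derivative Xf i (Xf i f) p) (at 0)"
  proof -
    have X: "Xf i f differentiable (at p)" by (rule Xf_differentiable[OF f])
    have "((\<lambda>s. Xf i f (p + s *\<^sub>R v)) has_derivative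
        (\<lambda>r. frechet_derivative (Xf i f) (at (p + 0 *\<^sub>R v)) (r *\<^sub>R v))) (at 0)"
      by (rule has_derivative_compose[OF line has_frechet_derivative]) (simp add: X)
    then show ?thesis
      by (simp add: has_field_derivative_def Xf_eq[OF X] linear_cmul[OF linear_frechet_derivative[OF X]]
          mult_commute_abs v_def)
  qed
  have h0: "Xf i f p = 0"
    using DERIV_local_max[OF h'[of 0], of 1] max by (simp add: h_def)
  \<comment> \<open>A positive second derivative together with h'(0) = 0 makes h' positive just
    after 0, so that \<open>h\<close> would rise above its maximum.\<close>
  obtain d where d: "d > 0" "\<And>s. 0 < s \<Longrightarrow> s < d \<Longrightarrow> 0 < Xf i f (p + s *\<^sub>R v)"
    using DERIV_pos_inc_right[OF h''] neg h0 by auto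
  have "h 0 < h (d / 2)"
  proof (rule DERIV_pos_imp_increasing_open[of 0 "d / 2" h])
    show "continuous_on {0..d / 2} h"
      by (rule DERIV_continuous_on[OF has_field_derivative_at_within[OF h']])
    show "\<exists>y. (h has_real_derivative y) (at x) \<and> 0 < y" if "0 < x" "x < d / 2" for x
      using h'[of x] d(2)[of x] that d(1) by auto
  qed (use d in simp)
  with max[of "p + (d / 2) *\<^sub>R v"] show False by (simp add: h_def)
qed

lemma subLaplacian_nonpos_at_max:
  assumes "Ck 2 f" "\<And>q. f q \<le> f p"
  shows "subLaplacian f p \<le> 0"
  unfolding subLaplacian_def by (intro sum_nonpos XfXf_nonpos_at_max assms)

lemma Cc_infinity_imp_Ck: "f \<in> Cc_infinity \<Longrightarrow> Ck k f"
  by (simp add: Cc_infinity_def)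

text \<open>If \<open>u\<close> exceeds \<open>B\<close> somewhere, then, \<open>B\<close> being
  nonnegative, the maximum over the compact support is a global one. There the sub-Laplacian is at
  most 0 and \<open>le\<close> bounds the maximum itself.\<close>

lemma Cc_infinity_dissipative:
  assumes u: "u \<in> Cc_infinity" and h: "0 < h" and B: "0 \<le> B"
    and le: "\<And>q. u q - h * subLaplacian u q \<le> B"
  shows "u q \<le> B"
proof (rule ccontr)
  assume neg: "\<not> u q \<le> B"
  define K where "K = closure {p. u p \<noteq> 0}"
  have K: "compact K" using u by (simp add: K_def Cc_infinity_def)
  have out: "u p = 0" if "p \<notin> K" for p
    using that closure_subset[of "{p. u p \<noteq> 0}"] by (auto simp: K_def)
  have "q \<in> K" using neg B out[of q] by (cases "q \<in> K") auto
  then obtain p where p: "p \<in> K" "\<And>r. r \<in> K \<Longrightarrow> u r \<le> u p"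
    using continuous_attains_sup[OF K _ continuous_on_subset[OF Ck_imp_continuous[OF Cc_infinity_imp_Ck[OF u, of 0]]]]
    by blast
  have up: "B < u p" using p(2)[OF \<open>q \<in> K\<close>] neg by simp
  have "u r \<le> u p" for r using p(2)[of r] out[of r] up B by (cases "r \<in> K") auto
  then have "subLaplacian u p \<le> 0" by (intro subLaplacian_nonpos_at_max Cc_infinity_imp_Ck u)
  then have "h * subLaplacian u p \<le> 0" using h by (simp add: mult_nonneg_nonpos)
  with le[of p] up show False by simp
qed

lemma closure_graph_dissipative:
  assumes fg: "(f, g) \<in> closure_graph subLaplacian" and h: "0 < h" and B: "0 \<le> B"
    and le: "\<And>q. f q - h * g q \<le> B"
  shows "f q \<le> B"
proof (rule field_le_epsilon)
  fix e :: real assume e: "0 < e"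
  obtain u where u: "\<And>m::nat. u m \<in> Cc_infinity" "uniform_limit UNIV u f sequentially"
    "uniform_limit UNIV (\<lambda>m. subLaplacian (u m)) g sequentially"
    using fg by (auto simp: closure_graph_def)
  \<comment> \<open>One quarter of \<open>e\<close> pays for replacing \<open>f\<close> by
    \<open>u m\<close>, one for \<open>h\<close> times the error of the Laplacians, and one for
    returning from \<open>u m\<close> to \<open>f\<close>.\<close>
  define d where "d = min (e / 4) (e / (4 * h))"
  have d: "0 < d" "d \<le> e / 4" "h * d \<le> e / 4" using e h by (auto simp: d_def field_simps min_def)
  have "eventually (\<lambda>m. (\<forall>q. dist (u m q) (f q) < d) \<and> (\<forall>q. dist (subLaplacian (u m) q) (g q) < d)) sequentially"
    using uniform_limitD[OF u(2) d(1)] uniform_limitD[OF u(3) d(1)] by eventually_elim auto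
  then obtain m where m: "\<And>q. \<bar>u m q - f q\<bar> < d" "\<And>q. \<bar>subLaplacian (u m) q - g q\<bar> < d"
    unfolding eventually_sequentially dist_real_def by (meson order_refl)
  have "u m q \<le> B + e / 2" for q
  proof (rule Cc_infinity_dissipative[OF u(1) h])
    show "u m q - h * subLaplacian (u m) q \<le> B + e / 2" for q
    proof -
      have "\<bar>h * (subLaplacian (u m) q - g q)\<bar> \<le> h * d"
        using m(2)[of q] h by (simp add: abs_mult)
      then show ?thesis using le[of q] m(1)[of q] d
        unfolding abs_le_iff abs_less_iff right_diff_distrib mult.commute[of h d] by linarith
    qed
  qed (use B e in simp)
  from this[of q] m(1)[of q] d show "f q \<le> B + e" by simp
qed

section \<open>Affine symmetries of the sub-Laplacian\<close>

text \<open>Common frame for left translations, with \<open>R\<close> the identity, and for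
  rotations. The linear part carries X_i to a combination of the X_j with constant orthogonal
  coefficients. The continuous \<open>psi\<close> confines preimages of compact sets to compact
  sets.\<close>

locale affine_symmetry =
  fixes phi psi L :: "'n::{card2,linorder} nil2 \<Rightarrow> 'n nil2" and c :: "'n nil2"
    and R :: "'n \<Rightarrow> 'n \<Rightarrow> real"
  assumes affine: "phi p = c + L p" and L: "bounded_linear L"
    and psi_phi: "psi (phi p) = p" and continuous_psi: "continuous_on UNIV psi"
    and L_lfield: "L (lfield i p) = (\<Sum>j\<in>UNIV. R j i *\<^sub>R lfield j (phi p))"
    and orthogonal: "(\<Sum>i\<in>UNIV. R j i * R k i) = (if j = k then 1 else 0)"
begin

lemma continuous_phi: "continuous_on UNIV phi"
  unfolding affine[abs_def] by (intro continuous_intros bounded_linear.continuous_on[OF L])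

lemma Xf_compose:
  assumes f: "f differentiable (at (phi p))"
  shows "Xf i (\<lambda>q. f (phi q)) p = (\<Sum>j\<in>UNIV. R j i * Xf j f (phi p))"
proof -
  interpret D: linear "frechet_derivative f (at (phi p))" by (rule linear_frechet_derivative[OF f])
  have der: "((\<lambda>q. f (phi q)) has_derivative (\<lambda>v. frechet_derivative f (at (phi p)) (L v))) (at p)"
    by (rule frechet_derivative_affine_compose[OF L affine f])
  then have "(\<lambda>q. f (phi q)) differentiable (at p)" by (auto simp: differentiable_def)
  then show ?thesis
    by (simp add: Xf_eq f frechet_derivative_eqI[OF der] L_lfield D.sum D.scaleR)
qed

text \<open>Since \<open>R\<close> does not depend on the point, the second application of X_i
  differentiates no coefficients; orthogonality then collapses the double sum over the fields to its
  diagonal.\<close>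

lemma subLaplacian_compose:
  assumes f: "Ck 2 f"
  shows "subLaplacian (\<lambda>q. f (phi q)) p = subLaplacian f (phi p)"
proof -
  note fd = Ck_2_differentiable[OF f]
  have Xd: "Xf j f differentiable (at q)" for j q by (rule Xf_differentiable[OF f])
  have X: "Xf i (\<lambda>q. f (phi q)) = (\<lambda>p. (\<lambda>q. \<Sum>j\<in>UNIV. R j i * Xf j f q) (phi p))" for i
    by (rule ext) (simp add: Xf_compose[OF fd])
  have "Xf i (Xf i (\<lambda>q. f (phi q))) p = (\<Sum>k\<in>UNIV. R k i * (\<Sum>j\<in>UNIV. R j i * Xf k (Xf j f) (phi p)))" for i
  proof -
    have der: "((\<lambda>q. \<Sum>j\<in>UNIV. R j i * Xf j f q) has_derivative
        (\<lambda>v. \<Sum>j\<in>UNIV. R j i * frechet_derivative (Xf j f) (at q) v)) (at q)" for q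
      by (intro has_derivative_sum has_derivative_mult_right has_frechet_derivative Xd)
    then have d: "(\<lambda>q. \<Sum>j\<in>UNIV. R j i * Xf j f q) differentiable (at q)" for q
      by (rule differentiableI)
    show ?thesis
      unfolding X by (subst Xf_compose[OF d]) (simp add: Xf_eq[OF d] frechet_derivative_eqI[OF der] Xf_eq[OF Xd])
  qed
  then have "subLaplacian (\<lambda>q. f (phi q)) p
      = (\<Sum>i\<in>UNIV. \<Sum>k\<in>UNIV. \<Sum>j\<in>UNIV. R k i * R j i * Xf k (Xf j f) (phi p))"
    by (simp add: subLaplacian_def sum_distrib_left mult.assoc)
  also have "\<dots> = (\<Sum>k\<in>UNIV. \<Sum>i\<in>UNIV. \<Sum>j\<in>UNIV. R k i * R j i * Xf k (Xf j f) (phi p))"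
    by (rule sum.swap)
  also have "\<dots> = (\<Sum>k\<in>UNIV. \<Sum>j\<in>UNIV. \<Sum>i\<in>UNIV. R k i * R j i * Xf k (Xf j f) (phi p))"
    by (rule sum.cong[OF refl], rule sum.swap)
  also have "\<dots> = (\<Sum>k\<in>UNIV. \<Sum>j\<in>UNIV. (if k = j then 1 else 0) * Xf k (Xf j f) (phi p))"
    by (simp add: sum_distrib_right[symmetric] orthogonal)
  also have "\<dots> = subLaplacian f (phi p)"
    by (simp add: subLaplacian_def if_distrib[of "\<lambda>x. x * _"] cong: if_cong)
  finally show ?thesis .
qed

lemma compact_preimage: "compact K \<Longrightarrow> compact (psi ` K)"
  by (intro compact_continuous_image continuous_on_subset[OF continuous_psi]) auto

lemma C_zero_compose:
  assumes f: "f \<in> C_zero"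
  shows "(\<lambda>p. f (phi p)) \<in> C_zero"
proof -
  \<comment> \<open>A point that \<open>phi\<close> sends into a ball lies in the image of that ball
    under \<open>psi\<close>, which is bounded.\<close>
  have "filterlim phi at_infinity at_infinity"
    unfolding filterlim_at_infinity_conv_norm_at_top filterlim_at_top eventually_at_infinity
  proof
    fix Z :: real
    obtain B where B: "\<And>q. q \<in> psi ` cball 0 Z \<Longrightarrow> norm q \<le> B"
      using compact_imp_bounded[OF compact_preimage[OF compact_cball]] by (meson bounded_iff)
    have "Z \<le> norm (phi p)" if "B + 1 \<le> norm p" for p
    proof (rule ccontr)
      assume "\<not> Z \<le> norm (phi p)"
      then have "psi (phi p) \<in> psi ` cball 0 Z" by (intro imageI) simp
      with B[of p] that show False by (simp add: psi_phi)
    qed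
    then show "\<exists>b. \<forall>x. b \<le> norm x \<longrightarrow> Z \<le> norm (phi x)" by blast
  qed
  with f show ?thesis
    unfolding C_zero_def
    by (auto intro: continuous_on_compose2[OF _ continuous_phi] filterlim_compose)
qed

lemma Cc_infinity_compose:
  assumes f: "f \<in> Cc_infinity"
  shows "(\<lambda>p. f (phi p)) \<in> Cc_infinity"
proof -
  define K where "K = closure {p. f p \<noteq> 0}"
  have K: "compact (psi ` K)" using f by (intro compact_preimage) (simp add: K_def Cc_infinity_def)
  have "{p. f (phi p) \<noteq> 0} \<subseteq> psi ` K"
  proof
    fix p assume "p \<in> {p. f (phi p) \<noteq> 0}"
    then have "phi p \<in> K" using closure_subset[of "{p. f p \<noteq> 0}"] by (auto simp: K_def)
    then have "psi (phi p) \<in> psi ` K" by (rule imageI)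
    then show "p \<in> psi ` K" by (simp add: psi_phi)
  qed
  then have "compact (closure {p. f (phi p) \<noteq> 0})"
    unfolding compact_closure by (rule bounded_subset[OF compact_imp_bounded[OF K]])
  with f show ?thesis by (auto simp: Cc_infinity_def intro!: Ck_affine_compose[OF L affine])
qed

lemma closure_graph_compose:
  assumes "(f, g) \<in> closure_graph subLaplacian"
  shows "((\<lambda>p. f (phi p)), (\<lambda>p. g (phi p))) \<in> closure_graph subLaplacian"
proof -
  obtain u where fg: "f \<in> C_zero" "g \<in> C_zero" and u: "\<And>m::nat. u m \<in> Cc_infinity" and
    lim: "uniform_limit UNIV u f sequentially" "uniform_limit UNIV (\<lambda>m. subLaplacian (u m)) g sequentially"
    using assms by (auto simp: closure_graph_def)
  have "uniform_limit UNIV (\<lambda>m p. u m (phi p)) (\<lambda>p. f (phi p)) sequentially"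
    "uniform_limit UNIV (\<lambda>m p. subLaplacian (u m) (phi p)) (\<lambda>p. g (phi p)) sequentially"
    by (rule uniform_limit_compose'[OF lim(1)], simp) (rule uniform_limit_compose'[OF lim(2)], simp)
  moreover have "subLaplacian (\<lambda>p. u m (phi p)) = (\<lambda>p. subLaplacian (u m) (phi p))" for m
    by (rule ext) (rule subLaplacian_compose[OF Cc_infinity_imp_Ck[OF u]])
  moreover have "(\<lambda>p. u m (phi p)) \<in> Cc_infinity" for m
    by (rule Cc_infinity_compose[OF u])
  ultimately have "\<exists>v. (\<forall>m::nat. v m \<in> Cc_infinity) \<and>
      uniform_limit UNIV v (\<lambda>p. f (phi p)) sequentially \<and>
      uniform_limit UNIV (\<lambda>m. subLaplacian (v m)) (\<lambda>p. g (phi p)) sequentially"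
    by (intro exI[of _ "\<lambda>m p. u m (phi p)"]) simp
  then show ?thesis
    unfolding closure_graph_def using C_zero_compose fg by simp
qed

end

section \<open>Rotations\<close>

text \<open>The second layer as an antisymmetric matrix Y, which removes the case distinctions on
  the order of the indices.\<close>

definition yext :: "(real, 'n::{card2,linorder} ordpair) vec \<Rightarrow> 'n \<Rightarrow> 'n \<Rightarrow> real" where
  "yext y i j = (if i < j then y $ Abs_ordpair (i, j) else if j < i then - y $ Abs_ordpair (j, i) else 0)"

lemma yext_less: "i < j \<Longrightarrow> yext y i j = y $ Abs_ordpair (i, j)"
  by (simp add: yext_def)

lemma yext_self [simp]: "yext y i i = 0"
  by (simp add: yext_def)

lemma yext_commute: "yext y i j = - yext y j i"
  by (auto simp: yext_def dest: less_asym)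

lemma yext_eqI:
  assumes less: "\<And>i j. i < j \<Longrightarrow> y $ Abs_ordpair (i, j) = W i j"
    and anti: "\<And>i j. W i j = - W j i"
  shows "yext y i j = W i j"
proof (cases i j rule: linorder_cases)
  case less
  then show ?thesis by (simp add: yext_less assms(1))
next
  case equal
  then show ?thesis using anti[of i i] by simp
next
  case greater
  then show ?thesis using anti[of i j] by (simp add: yext_commute[of y i] yext_less assms(1))
qed

lemma yext_area: "yext (area x x') i j = (x $ i * x' $ j - x $ j * x' $ i) / 2"
  by (rule yext_eqI) (simp_all add: area_nth field_simps)

lemma yext_add: "yext (y + z) i j = yext y i j + yext z i j"
  by (simp add: yext_def)

lemma yext_scaleR: "yext (r *\<^sub>R y) i j = r * yext y i j"
  by (simp add: yext_def)

text \<open>The action x to M x and Y to M Y M^T, that is, \<open>M\<close> on the first layer and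
  its second exterior power on the second.\<close>

definition mat_act :: "('n::{card2,linorder} \<Rightarrow> 'n \<Rightarrow> real) \<Rightarrow> 'n nil2 \<Rightarrow> 'n nil2" where
  "mat_act M p = (\<chi> k. \<Sum>a\<in>UNIV. M k a * fst p $ a,
    \<chi> c. case Rep_ordpair c of (k, l) \<Rightarrow> \<Sum>a\<in>UNIV. \<Sum>b\<in>UNIV. M k a * M l b * yext (snd p) a b)"

lemma fst_mat_act: "fst (mat_act M p) $ k = (\<Sum>a\<in>UNIV. M k a * fst p $ a)"
  by (simp add: mat_act_def)

lemma yext_mat_act:
  "yext (snd (mat_act M p)) k l = (\<Sum>a\<in>UNIV. \<Sum>b\<in>UNIV. M k a * M l b * yext (snd p) a b)"
proof (rule yext_eqI)
  show "snd (mat_act M p) $ Abs_ordpair (k, l)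
      = (\<Sum>a\<in>UNIV. \<Sum>b\<in>UNIV. M k a * M l b * yext (snd p) a b)" if "k < l" for k l
    using that by (simp add: mat_act_def Abs_ordpair_inverse)
  show "(\<Sum>a\<in>UNIV. \<Sum>b\<in>UNIV. M k a * M l b * yext (snd p) a b)
      = - (\<Sum>a\<in>UNIV. \<Sum>b\<in>UNIV. M l a * M k b * yext (snd p) a b)" for k l
  proof -
    have "(\<Sum>a\<in>UNIV. \<Sum>b\<in>UNIV. M k a * M l b * yext (snd p) a b)
        = (\<Sum>b\<in>UNIV. \<Sum>a\<in>UNIV. M k a * M l b * yext (snd p) a b)" by (rule sum.swap)
    also have "\<dots> = (\<Sum>b\<in>UNIV. \<Sum>a\<in>UNIV. - (M l b * M k a * yext (snd p) b a))"
    proof (intro sum.cong refl)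
      show "M k a * M l b * yext (snd p) a b = - (M l b * M k a * yext (snd p) b a)" for a b
        using yext_commute[of "snd p" a b] by simp
    qed
    finally show ?thesis by (simp add: sum_negf)
  qed
qed

lemma nil2_eqI:
  fixes p q :: "'n::{card2,linorder} nil2"
  assumes "\<And>k. fst p $ k = fst q $ k" "\<And>k l. k < l \<Longrightarrow> yext (snd p) k l = yext (snd q) k l"
  shows "p = q"
proof (rule prod_eqI)
  show "fst p = fst q" using assms(1) by (simp add: vec_eq_iff)
  show "snd p = snd q" using assms(2) by (intro ordpair_vec_eqI) (simp add: yext_less)
qed

lemma linear_mat_act: "linear (mat_act M)"
proof (rule linearI)
  show "mat_act M (p + q) = mat_act M p + mat_act M q" for p q
    by (rule nil2_eqI)
      (simp_all add: fst_mat_act yext_mat_act yext_add distrib_left sum.distrib)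
  show "mat_act M (r *\<^sub>R p) = r *\<^sub>R mat_act M p" for r p
    by (rule nil2_eqI)
      (simp_all add: fst_mat_act yext_mat_act yext_scaleR sum_distrib_left mult_ac)
qed

lemma mat_act_mat_act:
  "mat_act M (mat_act N p) = mat_act (\<lambda>i k. \<Sum>j\<in>UNIV. M i j * N j k) p"
proof (rule nil2_eqI)
  show "fst (mat_act M (mat_act N p)) $ k = fst (mat_act (\<lambda>i k. \<Sum>j\<in>UNIV. M i j * N j k) p) $ k" for k
    unfolding fst_mat_act sum_distrib_left sum_distrib_right
    by (subst sum.swap) (simp add: mult.assoc)
  show "yext (snd (mat_act M (mat_act N p))) k l
      = yext (snd (mat_act (\<lambda>i k. \<Sum>j\<in>UNIV. M i j * N j k) p)) k l" for k l
  proof -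
    let ?Y = "yext (snd p)"
    have "yext (snd (mat_act M (mat_act N p))) k l
        = (\<Sum>a\<in>UNIV. \<Sum>b\<in>UNIV. \<Sum>c\<in>UNIV. \<Sum>d\<in>UNIV. M k a * M l b * (N a c * N b d * ?Y c d))"
      by (simp add: yext_mat_act sum_distrib_left)
    also have "\<dots> = (\<Sum>a\<in>UNIV. \<Sum>c\<in>UNIV. \<Sum>b\<in>UNIV. \<Sum>d\<in>UNIV. M k a * M l b * (N a c * N b d * ?Y c d))"
      by (rule sum.cong[OF refl], rule sum.swap)
    also have "\<dots> = (\<Sum>c\<in>UNIV. \<Sum>a\<in>UNIV. \<Sum>b\<in>UNIV. \<Sum>d\<in>UNIV. M k a * M l b * (N a c * N b d * ?Y c d))"
      by (rule sum.swap)
    also have "\<dots> = (\<Sum>c\<in>UNIV. \<Sum>a\<in>UNIV. \<Sum>d\<in>UNIV. \<Sum>b\<in>UNIV. M k a * M l b * (N a c * N b d * ?Y c d))"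
      by (rule sum.cong[OF refl], rule sum.cong[OF refl], rule sum.swap)
    also have "\<dots> = (\<Sum>c\<in>UNIV. \<Sum>d\<in>UNIV. \<Sum>a\<in>UNIV. \<Sum>b\<in>UNIV. M k a * M l b * (N a c * N b d * ?Y c d))"
      by (rule sum.cong[OF refl], rule sum.swap)
    also have "\<dots> = (\<Sum>c\<in>UNIV. \<Sum>d\<in>UNIV. (\<Sum>a\<in>UNIV. M k a * N a c) * (\<Sum>b\<in>UNIV. M l b * N b d) * ?Y c d)"
      by (intro sum.cong refl)
        (subst sum_product, simp only: sum_distrib_right, intro sum.cong refl, simp only: mult_ac)
    finally show ?thesis by (simp add: yext_mat_act)
  qed
qed

lemma mat_act_id: "mat_act (\<lambda>i j. if i = j then 1 else 0) p = p"
proof (rule nil2_eqI)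
  show "fst (mat_act (\<lambda>i j. if i = j then 1 else 0) p) $ k = fst p $ k" for k
    by (simp add: fst_mat_act if_distrib[of "\<lambda>x. x * _"] cong: if_cong)
  show "yext (snd (mat_act (\<lambda>i j. if i = j then 1 else 0) p)) k l = yext (snd p) k l" for k l
  proof -
    have "yext (snd (mat_act (\<lambda>i j. if i = j then 1 else 0) p)) k l
        = (\<Sum>a\<in>UNIV. \<Sum>b\<in>UNIV. if l = b then (if k = a then yext (snd p) a b else 0) else 0)"
      unfolding yext_mat_act by (intro sum.cong refl) simp
    then show ?thesis by simp
  qed
qed

text \<open>The form \<open>area\<close> is equivariant: the action sends \<open>area x x'\<close>
  to the area of M x and M x'. Column i of \<open>M\<close> is M e_i, and the sum on the right is
  the left invariant field in this direction.\<close>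

lemma mat_act_lfield:
  "mat_act M (lfield i p) = (\<Sum>j\<in>UNIV. M j i *\<^sub>R lfield j (mat_act M p))"
proof -
  have col: "(\<Sum>j\<in>UNIV. M j i *\<^sub>R axis j 1) = (\<chi> k. M k i)"
    using axis_expand[of "\<chi> k. M k i"] by simp
  have "(\<Sum>j\<in>UNIV. M j i *\<^sub>R lfield j (mat_act M p))
      = (\<Sum>j\<in>UNIV. M j i *\<^sub>R axis j 1, area (fst (mat_act M p)) (\<Sum>j\<in>UNIV. M j i *\<^sub>R axis j 1))"
    by (simp add: lfield_def prod_eq_iff fst_sum snd_sum area.sum_right area.scaleR_right)
  also have "\<dots> = mat_act M (lfield i p)" unfolding col
  proof (rule nil2_eqI)
    show "fst (\<chi> k. M k i, area (fst (mat_act M p)) (\<chi> k. M k i)) $ k = fst (mat_act M (lfield i p)) $ k" for k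
      by (simp add: fst_mat_act lfield_def axis_def if_distrib[of "\<lambda>x. _ * x"] cong: if_cong)
    fix k l :: 'a
    let ?x = "fst p" and ?e = "\<lambda>a. if a = i then 1 else 0 :: real"
    have "yext (snd (mat_act M (lfield i p))) k l
        = (\<Sum>a\<in>UNIV. \<Sum>b\<in>UNIV. M k a * M l b * ((?x $ a * ?e b - ?x $ b * ?e a) / 2))"
      by (simp add: yext_mat_act lfield_def yext_area axis_def)
    also have "\<dots> = ((\<Sum>a\<in>UNIV. \<Sum>b\<in>UNIV. (M k a * ?x $ a) * (M l b * ?e b))
        - (\<Sum>a\<in>UNIV. \<Sum>b\<in>UNIV. (M k a * ?e a) * (M l b * ?x $ b))) / 2"
      by (simp add: sum_subtractf[symmetric] sum_divide_distrib algebra_simps del: mult_cancel_left2 mult_cancel_right2)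
    also have "\<dots> = ((\<Sum>a\<in>UNIV. M k a * ?x $ a) * (\<Sum>b\<in>UNIV. M l b * ?e b)
        - (\<Sum>a\<in>UNIV. M k a * ?e a) * (\<Sum>b\<in>UNIV. M l b * ?x $ b)) / 2"
      by (simp only: sum_product)
    also have "\<dots> = ((\<Sum>a\<in>UNIV. M k a * ?x $ a) * M l i - M k i * (\<Sum>b\<in>UNIV. M l b * ?x $ b)) / 2"
      by (simp add: if_distrib[of "\<lambda>x. _ * x"] cong: if_cong)
    finally show "yext (snd (\<chi> k. M k i, area (fst (mat_act M p)) (\<chi> k. M k i))) k l
        = yext (snd (mat_act M (lfield i p))) k l"
      by (simp add: yext_area fst_mat_act mult.commute)
  qed
  finally show ?thesis ..
qed

lemma affine_symmetry_mat_act: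
  assumes rows: "\<And>j k. (\<Sum>i\<in>UNIV. M j i * M k i) = (if j = k then 1 else 0)"
    and columns: "\<And>j k. (\<Sum>i\<in>UNIV. M i j * M i k) = (if j = k then 1 else 0)"
  shows "affine_symmetry (mat_act M) (mat_act (\<lambda>i j. M j i)) (mat_act M) 0 M"
proof (rule affine_symmetry.intro)
  show "continuous_on UNIV (mat_act (\<lambda>i j. M j i))"
    by (rule linear_continuous_on) (simp add: linear_mat_act linear_conv_bounded_linear[symmetric])
qed (simp_all add: linear_mat_act linear_conv_bounded_linear[symmetric] mat_act_mat_act mat_act_id
    mat_act_lfield rows columns)

text \<open>The sign of s is chosen so that the velocity at s = 0 is x_j in coordinate i and - x_i
  in coordinate j, as in \<open>rot i j\<close>.\<close>

definition rot_mat :: "'n \<Rightarrow> 'n \<Rightarrow> real \<Rightarrow> 'n \<Rightarrow> 'n \<Rightarrow> real" where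
  "rot_mat i j s k a =
    (if k = i then (if a = i then cos s else if a = j then sin s else 0)
     else if k = j then (if a = i then - sin s else if a = j then cos s else 0)
     else if a = k then 1 else 0)"

lemma sum_two_points:
  fixes i j :: "'n::finite" and g :: "'n \<Rightarrow> real"
  assumes "i \<noteq> j"
  shows "(\<Sum>a\<in>UNIV. (if a = i then c else if a = j then d else 0) * g a) = c * g i + d * g j"
proof -
  have "(\<Sum>a\<in>UNIV. (if a = i then c else if a = j then d else 0) * g a)
      = (\<Sum>a\<in>UNIV. (if a = i then c * g i else 0) + (if a = j then d * g j else 0))"
    using assms by (intro sum.cong) auto
  then show ?thesis by (simp add: sum.distrib)
qed

lemma sum_rot_mat:
  fixes i j :: "'n::finite" and g :: "'n \<Rightarrow> real"
  assumes "i \<noteq> j"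
  shows "(\<Sum>a\<in>UNIV. rot_mat i j s k a * g a) =
    (if k = i then cos s * g i + sin s * g j else if k = j then - sin s * g i + cos s * g j else g k)"
proof -
  consider "k = i" | "k = j" "k \<noteq> i" | "k \<noteq> i" "k \<noteq> j" by blast
  then show ?thesis
  proof cases
    case 1
    then show ?thesis by (simp add: rot_mat_def sum_two_points[OF assms])
  next
    case 2
    then have "(\<Sum>a\<in>UNIV. rot_mat i j s k a * g a)
        = (\<Sum>a\<in>UNIV. (if a = i then - sin s else if a = j then cos s else 0) * g a)"
      by (simp add: rot_mat_def)
    also have "\<dots> = - sin s * g i + cos s * g j" by (rule sum_two_points[OF assms])
    finally show ?thesis using 2 by simp
  next
    case 3
    then show ?thesis
      by (simp add: rot_mat_def if_distrib[of "\<lambda>x. x * _"] cong: if_cong)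
  qed
qed

lemma rot_mat_transpose: "i \<noteq> j \<Longrightarrow> rot_mat i j s k a = rot_mat i j (- s) a k"
  by (simp add: rot_mat_def)

lemma rot_mat_rows:
  fixes i j :: "'n::finite"
  assumes "i \<noteq> j"
  shows "(\<Sum>a\<in>UNIV. rot_mat i j s k a * rot_mat i j s l a) = (if k = l then 1 else 0)"
  using assms sin_cos_squared_add[of s]
  by (simp add: sum_rot_mat) (auto simp: rot_mat_def power2_eq_square)

lemma rot_mat_columns:
  fixes i j :: "'n::finite"
  assumes "i \<noteq> j"
  shows "(\<Sum>a\<in>UNIV. rot_mat i j s a k * rot_mat i j s a l) = (if k = l then 1 else 0)"
  using rot_mat_rows[OF assms, of "- s"] by (simp add: rot_mat_transpose[OF assms, of s])

lemma mat_act_rot_mat_0: "mat_act (rot_mat i j 0) p = p"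
proof -
  have "rot_mat i j 0 = (\<lambda>i j. if i = j then 1 else 0)" by (auto simp: rot_mat_def fun_eq_iff)
  then show ?thesis by (simp add: mat_act_id)
qed

definition rot_field :: "'n::{card2,linorder} \<Rightarrow> 'n \<Rightarrow> 'n nil2 \<Rightarrow> 'n nil2" where
  "rot_field i j p = (fst p $ j *\<^sub>R axis i 1 - fst p $ i *\<^sub>R axis j 1,
    \<Sum>k\<in>UNIV. yext (snd p) k j *\<^sub>R ybasis k i - yext (snd p) k i *\<^sub>R ybasis k j)"

lemma frechet_derivative_rot_field:
  assumes f: "f differentiable (at p)"
  shows "frechet_derivative f (at p) (rot_field i j p)
    = fst p $ j * dx i f p - fst p $ i * dx j f p
      + (\<Sum>k\<in>UNIV. yext (snd p) k j * frechet_derivative f (at p) (0, ybasis k i)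
                - yext (snd p) k i * frechet_derivative f (at p) (0, ybasis k j))"
proof -
  interpret D: linear "frechet_derivative f (at p)" by (rule linear_frechet_derivative[OF f])
  have "rot_field i j p = fst p $ j *\<^sub>R (axis i 1, 0) - fst p $ i *\<^sub>R (axis j 1, 0)
      + (\<Sum>k\<in>UNIV. yext (snd p) k j *\<^sub>R (0, ybasis k i) - yext (snd p) k i *\<^sub>R (0, ybasis k j))"
    by (simp add: rot_field_def prod_eq_iff fst_sum snd_sum)
  then show ?thesis
    by (simp add: D.add D.diff D.sum D.scaleR dx_def del: scaleR_Pair diff_Pair add_Pair)
qed

text \<open>In the unordered sum the terms for i and j vanish because diagonal entries do. The
  remaining indices fall into the three ranges of \<open>rot\<close>, and reordering the index pairs
  produces the signs there.\<close>

lemma rot_eq: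
  assumes f: "f differentiable (at p)" and ij: "i < j"
  shows "rot i j f p = frechet_derivative f (at p) (rot_field i j p)"
proof -
  interpret D: linear "frechet_derivative f (at p)" by (rule linear_frechet_derivative[OF f])
  define B where "B k l = frechet_derivative f (at p) (0, ybasis k l)" for k l
  define Y where "Y = yext (snd p)"
  have B_self: "B k k = 0" for k using D.zero by (simp add: B_def zero_prod_def)
  have Y_self: "Y k k = 0" for k by (simp add: Y_def)
  have dy1: "k < l \<Longrightarrow> dy k l f p = B k l" for k l by (simp add: B_def dy_less)
  have dy2: "l < k \<Longrightarrow> dy l k f p = - B k l" for k l by (simp add: B_def dy_greater[OF f])
  have yc1: "k < l \<Longrightarrow> yc k l p = Y k l" for k l by (simp add: Y_def yc_def yext_less)
  have yc2: "l < k \<Longrightarrow> yc l k p = - Y k l" for k l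
    by (simp add: Y_def yc_def yext_less yext_commute[of "snd p" k])
  define g where "g k = Y k j * B k i - Y k i * B k j" for k
  have "(\<Sum>k\<in>UNIV. g k) = (\<Sum>k\<in>{..<i}. g k) + g i + (\<Sum>k\<in>{i<..}. g k)" by (rule sum_UNIV_split)
  also have "{i<..} = ({i<..<j} \<union> {j}) \<union> {j<..}" using ij by auto
  also have "(\<Sum>k\<in>({i<..<j} \<union> {j}) \<union> {j<..}. g k) = (\<Sum>k\<in>{i<..<j} \<union> {j}. g k) + (\<Sum>k\<in>{j<..}. g k)"
    by (rule sum.union_disjoint) auto
  also have "(\<Sum>k\<in>{i<..<j} \<union> {j}. g k) = (\<Sum>k\<in>{i<..<j}. g k) + g j"
    by (subst sum.union_disjoint) auto
  finally have "(\<Sum>k\<in>UNIV. g k) = (\<Sum>k\<in>{..<i}. g k) + (\<Sum>k\<in>{i<..<j}. g k) + (\<Sum>k\<in>{j<..}. g k)"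
    by (simp add: g_def B_self Y_self)
  moreover have "(\<Sum>k\<in>{..<i}. g k) = (\<Sum>k\<in>{..<i}. yc k j p * dy k i f p - yc k i p * dy k j f p)"
  proof (rule sum.cong[OF refl])
    fix k assume "k \<in> {..<i}"
    then have "k < i" "k < j" using ij by auto
    then show "g k = yc k j p * dy k i f p - yc k i p * dy k j f p" by (simp add: g_def yc1 dy1)
  qed
  moreover have "(\<Sum>k\<in>{i<..<j}. g k) = (\<Sum>k\<in>{i<..<j}. yc i k p * dy k j f p - yc k j p * dy i k f p)"
    by (rule sum.cong[OF refl]) (simp add: g_def yc1[of _ j] dy1[of _ j] yc2[of i] dy2[of i])
  moreover have "(\<Sum>k\<in>{j<..}. g k) = (\<Sum>k\<in>{j<..}. yc j k p * dy i k f p - yc i k p * dy j k f p)"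
  proof (rule sum.cong[OF refl])
    fix k assume "k \<in> {j<..}"
    then have "i < k" "j < k" using ij by auto
    then show "g k = yc j k p * dy i k f p - yc i k p * dy j k f p" by (simp add: g_def yc2 dy2)
  qed
  ultimately show ?thesis
    unfolding frechet_derivative_rot_field[OF f] rot_def xc_def
    by (simp add: g_def B_def Y_def)
qed

text \<open>These are the entries of A Y + Y A^T, where A is the infinitesimal rotation with entries
  1 at (i, j) and -1 at (j, i).\<close>

lemma yext_rot_field:
  "k < l \<Longrightarrow> yext (snd (rot_field i j p)) k l =
    (if k = i then yext (snd p) j l else 0) - (if k = j then yext (snd p) i l else 0)
    + (if l = i then yext (snd p) k j else 0) - (if l = j then yext (snd p) k i else 0)"
proof -
  assume kl: "k < l"
  let ?Y = "yext (snd p)"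
  have pick: "(\<Sum>m\<in>UNIV. h m * ((if m = k \<and> r = l then 1 else 0) - (if m = l \<and> r = k then 1 else 0)))
      = (if r = l then h k else 0) - (if r = k then h l else 0)" for h :: "'a \<Rightarrow> real" and r
  proof -
    have "(\<Sum>m\<in>UNIV. h m * ((if m = k \<and> r = l then 1 else 0) - (if m = l \<and> r = k then 1 else 0)))
        = (\<Sum>m\<in>UNIV. (if m = k then (if r = l then h k else 0) else 0)
            - (if m = l then (if r = k then h l else 0) else 0))"
      by (rule sum.cong) auto
    then show ?thesis by (simp add: sum_subtractf)
  qed
  have "yext (snd (rot_field i j p)) k l
      = (\<Sum>m\<in>UNIV. ?Y m j * (ybasis m i $ Abs_ordpair (k, l)) - ?Y m i * (ybasis m j $ Abs_ordpair (k, l)))"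
    using kl by (simp add: rot_field_def yext_less)
  also have "\<dots> = ((if i = l then ?Y k j else 0) - (if i = k then ?Y l j else 0))
      - ((if j = l then ?Y k i else 0) - (if j = k then ?Y l i else 0))"
    unfolding ybasis_nth[OF kl] sum_subtractf pick ..
  finally show ?thesis using yext_commute[of "snd p" l] by (auto split: if_splits)
qed

text \<open>The equation M' = A M for the infinitesimal rotation A: the derivative of row i is row
  j, that of row j is minus row i.\<close>

lemma rot_mat_has_derivative:
  assumes "i \<noteq> j"
  shows "((\<lambda>s. rot_mat i j s k a) has_real_derivative
    (if k = i then rot_mat i j s j a else 0) - (if k = j then rot_mat i j s i a else 0)) (at s)"
proof -
  consider "k = i" | "k = j" "k \<noteq> i" | "k \<noteq> i" "k \<noteq> j" by blast
  then show ?thesis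
    by cases (use assms in \<open>auto simp: rot_mat_def intro!: derivative_eq_intros\<close>)
qed

text \<open>Stated at every \<open>s\<close> and not only at 0, since a function with vanishing
  rotation derivative has to be shown constant along the whole orbit.\<close>

lemma rotation_flow:
  fixes i j :: "'n::{card2,linorder}"
  assumes ij: "i \<noteq> j"
  shows "((\<lambda>s. mat_act (rot_mat i j s) p) has_vector_derivative
    rot_field i j (mat_act (rot_mat i j s) p)) (at s)"
proof -
  define M where "M = rot_mat i j"
  define q where "q = mat_act (M s) p"
  let ?Y = "yext (snd p)"
  note D = rot_mat_has_derivative[OF ij, of _ _ s, folded M_def]
  have 1: "((\<lambda>s. fst (mat_act (M s) p) $ k) has_real_derivative fst (rot_field i j q) $ k) (at s)" for k
  proof -
    have "((\<lambda>s. fst (mat_act (M s) p) $ k) has_real_derivative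
       (\<Sum>a\<in>UNIV. ((if k = i then M s j a else 0) - (if k = j then M s i a else 0)) * fst p $ a)) (at s)"
      unfolding fst_mat_act by (intro DERIV_sum DERIV_cmult_right D)
    moreover have "(\<Sum>a\<in>UNIV. ((if k = i then M s j a else 0) - (if k = j then M s i a else 0)) * fst p $ a)
        = fst (rot_field i j q) $ k"
      by (simp add: rot_field_def q_def fst_mat_act axis_def left_diff_distrib sum_subtractf)
    ultimately show ?thesis by simp
  qed
  have 2: "((\<lambda>s. yext (snd (mat_act (M s) p)) k l) has_real_derivative yext (snd (rot_field i j q)) k l) (at s)"
    if kl: "k < l" for k l
  proof -
    let ?D = "\<lambda>k a. (if k = i then M s j a else 0) - (if k = j then M s i a else 0)"
    have "((\<lambda>s. yext (snd (mat_act (M s) p)) k l) has_real_derivative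
       (\<Sum>a\<in>UNIV. \<Sum>b\<in>UNIV. (?D k a * M s l b + ?D l b * M s k a) * ?Y a b)) (at s)"
      unfolding yext_mat_act by (intro DERIV_sum DERIV_cmult_right DERIV_mult D)
    moreover have "(\<Sum>a\<in>UNIV. \<Sum>b\<in>UNIV. (?D k a * M s l b + ?D l b * M s k a) * ?Y a b)
        = yext (snd (rot_field i j q)) k l"
    proof -
      define W where "W k l = yext (snd q) k l" for k l
      have W: "W k l = (\<Sum>a\<in>UNIV. \<Sum>b\<in>UNIV. M s k a * M s l b * ?Y a b)" for k l
        by (simp add: W_def q_def yext_mat_act)
      have "(\<Sum>a\<in>UNIV. \<Sum>b\<in>UNIV. ?D k a * M s l b * ?Y a b)
          = (if k = i then W j l else 0) - (if k = j then W i l else 0)"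
        unfolding W by (cases "k = i"; cases "k = j") (use ij in \<open>simp_all add: sum_negf\<close>)
      moreover have "(\<Sum>a\<in>UNIV. \<Sum>b\<in>UNIV. M s k a * ?D l b * ?Y a b)
          = (if l = i then W k j else 0) - (if l = j then W k i else 0)"
        unfolding W by (cases "l = i"; cases "l = j") (use ij in \<open>simp_all add: sum_negf\<close>)
      moreover have "(\<Sum>a\<in>UNIV. \<Sum>b\<in>UNIV. (?D k a * M s l b + ?D l b * M s k a) * ?Y a b)
          = (\<Sum>a\<in>UNIV. \<Sum>b\<in>UNIV. ?D k a * M s l b * ?Y a b)
            + (\<Sum>a\<in>UNIV. \<Sum>b\<in>UNIV. M s k a * ?D l b * ?Y a b)"
        by (simp only: distrib_right sum.distrib mult.commute[of "?D l _" "M s k _"])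
      ultimately show ?thesis
        unfolding yext_rot_field[OF kl] W_def by simp
    qed
    ultimately show ?thesis by simp
  qed
  have fstD: "((\<lambda>s. fst (mat_act (M s) p)) has_vector_derivative fst (rot_field i j q)) (at s)"
    unfolding has_vector_derivative_def
    by (subst has_derivative_componentwise_within)
      (use 1 in \<open>auto simp: Basis_vec_def inner_axis has_field_derivative_def mult_commute_abs\<close>)
  have sndD: "((\<lambda>s. snd (mat_act (M s) p)) has_vector_derivative snd (rot_field i j q)) (at s)"
    unfolding has_vector_derivative_def
  proof (subst has_derivative_componentwise_within, rule ballI)
    fix b :: "(real, 'n ordpair) vec" assume "b \<in> Basis"
    then obtain c where b: "b = axis c 1" by (auto simp: Basis_vec_def)
    obtain k l where kl: "Rep_ordpair c = (k, l)" by (cases "Rep_ordpair c")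
    then have "k < l" "c = Abs_ordpair (k, l)" using Rep_ordpair[of c] Rep_ordpair_inverse[of c] by auto
    with 2[OF this(1)]
    show "((\<lambda>s. snd (mat_act (M s) p) \<bullet> b) has_derivative (\<lambda>x. x *\<^sub>R snd (rot_field i j q) \<bullet> b)) (at s)"
      by (simp add: b inner_axis yext_less has_field_derivative_def mult_commute_abs)
  qed
  show ?thesis
    using has_vector_derivative_Pair[OF fstD sndD] by (simp add: M_def q_def)
qed

lemma rotation_flow_compose:
  assumes ij: "i < j" and f: "f differentiable (at (mat_act (rot_mat i j s) p))"
  shows "((\<lambda>s. f (mat_act (rot_mat i j s) p)) has_real_derivative
    rot i j f (mat_act (rot_mat i j s) p)) (at s)"
proof -
  define q where "q = mat_act (rot_mat i j s) p"
  have "((\<lambda>s. mat_act (rot_mat i j s) p) has_derivative (\<lambda>r. r *\<^sub>R rot_field i j q)) (at s)"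
    using rotation_flow[of i j p s] ij by (simp add: has_vector_derivative_def q_def)
  from has_derivative_compose[OF this has_frechet_derivative[OF f]]
  have "((\<lambda>s. f (mat_act (rot_mat i j s) p)) has_derivative
      (\<lambda>r. r * frechet_derivative f (at q) (rot_field i j q))) (at s)"
    by (simp add: q_def linear_cmul[OF linear_frechet_derivative[OF f]])
  then show ?thesis
    by (simp add: has_field_derivative_def rot_eq[OF f ij] q_def mult_commute_abs)
qed

lemma rotation_invariant_if_rot_zero:
  assumes "i < j" "\<And>p. f differentiable (at p)" "\<And>p. rot i j f p = 0"
  shows "f (mat_act (rot_mat i j s) p) = f p"
proof -
  have "((\<lambda>s. f (mat_act (rot_mat i j s) p)) has_real_derivative 0) (at s)" for s
    using rotation_flow_compose[OF assms(1,2), where s = s and p = p] assms(3) by simp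
  then have "f (mat_act (rot_mat i j s) p) = f (mat_act (rot_mat i j 0) p)"
    by (rule DERIV_isconst_all[rule_format])
  then show ?thesis by (simp add: mat_act_rot_mat_0)
qed

text \<open>The converse direction serves \<open>P t f\<close>, for which invariance comes from the
  semigroup and differentiability is all that is available.\<close>

lemma rot_zero_if_rotation_invariant:
  assumes "i < j" "f differentiable (at p)" "\<And>s. f (mat_act (rot_mat i j s) p) = f p"
  shows "rot i j f p = 0"
proof -
  have "((\<lambda>s. f (mat_act (rot_mat i j s) p)) has_real_derivative rot i j f p) (at 0)"
    using rotation_flow_compose[OF assms(1), of f 0 p] assms(2) by (simp add: mat_act_rot_mat_0)
  then show ?thesis unfolding assms(3) using DERIV_const DERIV_unique by blast
qed

section \<open>Left and right invariant gradients of radial functions\<close>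

text \<open>The velocity at s = 0 of \<open>p\<close> multiplied on the left by (s e_i, 0).\<close>

definition rfield :: "'n::{card2,linorder} \<Rightarrow> 'n nil2 \<Rightarrow> 'n nil2" where
  "rfield i p = (axis i 1, area (axis i 1) (fst p))"

text \<open>The two sums of squares differ by 2 S. Since \<open>B\<close> is antisymmetric, 2 S
  involves only the combinations x_k F_i - x_i F_k, which \<open>rot\<close> expresses through
  \<open>Y\<close> and \<open>B\<close>; the result is -2 Q.\<close>

lemma antisymmetric_gradient_identity:
  fixes x F :: "'n::finite \<Rightarrow> real" and B Y :: "'n \<Rightarrow> 'n \<Rightarrow> real"
  assumes B: "\<And>k l. B k l = - B l k" and Y: "\<And>k l. Y k l = - Y l k"
    and rot: "\<And>i j. x j * F i - x i * F j + (\<Sum>k\<in>UNIV. Y k j * B k i - Y k i * B k j) = 0"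
  shows "(\<Sum>i\<in>UNIV. (F i + 1/2 * (\<Sum>k\<in>UNIV. x k * B k i))\<^sup>2)
    = (\<Sum>i\<in>UNIV. (F i - 1/2 * (\<Sum>k\<in>UNIV. x k * B k i))\<^sup>2)"
proof -
  define S where "S = (\<Sum>i\<in>UNIV. F i * (\<Sum>k\<in>UNIV. x k * B k i))"
  \<comment> \<open>This is the trace of B B^T Y, with B B^T symmetric and Y antisymmetric, so it
    vanishes.\<close>
  define Q where "Q = (\<Sum>i\<in>UNIV. \<Sum>k\<in>UNIV. \<Sum>m\<in>UNIV. B k i * B m i * Y m k)"
  have "Q = (\<Sum>i\<in>UNIV. \<Sum>m\<in>UNIV. \<Sum>k\<in>UNIV. B k i * B m i * Y m k)"
    unfolding Q_def by (rule sum.cong[OF refl], rule sum.swap)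
  also have "\<dots> = (\<Sum>i\<in>UNIV. \<Sum>m\<in>UNIV. \<Sum>k\<in>UNIV. - (B m i * B k i * Y k m))"
    by (intro sum.cong refl) (subst Y, simp)
  also have "\<dots> = - Q" by (simp add: Q_def sum_negf)
  finally have Q0: "Q = 0" by simp
  \<comment> \<open>The same trace with two indices exchanged; one transposition of \<open>B\<close>
    accounts for the sign.\<close>
  have Q': "(\<Sum>i\<in>UNIV. \<Sum>k\<in>UNIV. \<Sum>m\<in>UNIV. B k i * B m k * Y m i) = - Q"
  proof -
    have "(\<Sum>i\<in>UNIV. \<Sum>k\<in>UNIV. \<Sum>m\<in>UNIV. B k i * B m k * Y m i)
        = (\<Sum>k\<in>UNIV. \<Sum>i\<in>UNIV. \<Sum>m\<in>UNIV. B k i * B m k * Y m i)" by (rule sum.swap)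
    also have "\<dots> = (\<Sum>k\<in>UNIV. \<Sum>i\<in>UNIV. \<Sum>m\<in>UNIV. - (B i k * B m k * Y m i))"
    proof (intro sum.cong refl)
      show "B k i * B m k * Y m i = - (B i k * B m k * Y m i)" for k i m
        using B[of k i] by simp
    qed
    also have "\<dots> = - Q" by (simp add: Q_def sum_negf)
    finally show ?thesis .
  qed
  have S1: "S = (\<Sum>i\<in>UNIV. \<Sum>k\<in>UNIV. x k * F i * B k i)"
    by (simp add: S_def sum_distrib_left mult_ac)
  have "S = (\<Sum>k\<in>UNIV. \<Sum>i\<in>UNIV. x k * F i * B k i)" unfolding S1 by (rule sum.swap)
  also have "\<dots> = (\<Sum>i\<in>UNIV. \<Sum>k\<in>UNIV. - (x i * F k * B k i))"
  proof (intro sum.cong refl)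
    show "x k * F i * B k i = - (x k * F i * B i k)" for k i using B[of k i] by simp
  qed
  finally have "2 * S = (\<Sum>i\<in>UNIV. \<Sum>k\<in>UNIV. (x k * F i - x i * F k) * B k i)"
    using S1 by (simp add: left_diff_distrib sum_subtractf sum_negf)
  also have "\<dots> = (\<Sum>i\<in>UNIV. \<Sum>k\<in>UNIV. - (\<Sum>m\<in>UNIV. Y m k * B m i - Y m i * B m k) * B k i)"
  proof -
    have "x k * F i - x i * F k = - (\<Sum>m\<in>UNIV. Y m k * B m i - Y m i * B m k)" for i k
      using rot[of k i] by linarith
    then show ?thesis by (simp only:)
  qed
  also have "\<dots> = (\<Sum>i\<in>UNIV. \<Sum>k\<in>UNIV. \<Sum>m\<in>UNIV. B k i * B m k * Y m i) - Q"
    by (simp add: Q_def sum_distrib_left sum_distrib_right sum_subtractf sum_negf algebra_simps)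
  finally have "S = 0" using Q' Q0 by simp
  have square: "(a + 1/2 * b)\<^sup>2 - (a - 1/2 * b)\<^sup>2 = 2 * (a * b)" for a b :: real
    by (simp add: power2_eq_square algebra_simps)
  have "(\<Sum>i\<in>UNIV. (F i + 1/2 * (\<Sum>k\<in>UNIV. x k * B k i))\<^sup>2)
      - (\<Sum>i\<in>UNIV. (F i - 1/2 * (\<Sum>k\<in>UNIV. x k * B k i))\<^sup>2) = 2 * S"
    by (simp only: S_def sum_subtractf[symmetric] square sum_distrib_left[of 2])
  with \<open>S = 0\<close> show ?thesis by simp
qed

text \<open>\<open>lfield\<close> and \<open>rfield\<close> differ only by the sign of the
  second-layer part, which is the sign between the two sums of squares above. Everything is
  evaluated at the single point \<open>p\<close>.\<close>

lemma norm_hgrad_eq_right_gradient: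
  assumes f: "f differentiable (at p)" and rot: "\<And>i j. i < j \<Longrightarrow> rot i j f p = 0"
  shows "norm (hgrad f p) = sqrt (\<Sum>i\<in>UNIV. (frechet_derivative f (at p) (rfield i p))\<^sup>2)"
proof -
  interpret D: linear "frechet_derivative f (at p)" by (rule linear_frechet_derivative[OF f])
  define F where "F i = frechet_derivative f (at p) (axis i 1, 0)" for i
  define B where "B k l = frechet_derivative f (at p) (0, ybasis k l)" for k l
  define x where "x k = fst p $ k" for k
  define Y where "Y = yext (snd p)"
  have B: "B k l = - B l k" for k l
    using D.neg[of "(0, ybasis l k)"] by (simp add: B_def ybasis_commute[of k])
  have Y: "Y k l = - Y l k" for k l unfolding Y_def by (rule yext_commute)
  have area: "frechet_derivative f (at p) (0, area (fst p) (axis i 1)) = 1/2 * (\<Sum>k\<in>UNIV. x k * B k i)" for i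
  proof -
    have "(0, area (fst p) (axis i 1)) = (1/2) *\<^sub>R (\<Sum>k\<in>UNIV. x k *\<^sub>R (0, ybasis k i))"
      by (simp add: area_axis x_def prod_eq_iff fst_sum snd_sum)
    then have "frechet_derivative f (at p) (0, area (fst p) (axis i 1))
        = frechet_derivative f (at p) ((1/2) *\<^sub>R (\<Sum>k\<in>UNIV. x k *\<^sub>R (0, ybasis k i)))" by (rule arg_cong)
    then show ?thesis by (simp add: D.scaleR D.sum B_def del: scaleR_Pair)
  qed
  have l: "Xf i f p = F i + 1/2 * (\<Sum>k\<in>UNIV. x k * B k i)" for i
    using D.add[of "(axis i 1, 0)" "(0, area (fst p) (axis i 1))"]
    by (simp add: Xf_eq[OF f] lfield_def F_def area)
  have r: "frechet_derivative f (at p) (rfield i p) = F i - 1/2 * (\<Sum>k\<in>UNIV. x k * B k i)" for i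
    using D.diff[of "(axis i 1, 0)" "(0, area (fst p) (axis i 1))"]
    by (simp add: rfield_def F_def area area_commute[of "axis i 1"])
  have eq0: "x j * F i - x i * F j + (\<Sum>k\<in>UNIV. Y k j * B k i - Y k i * B k j) = 0" if "i < j" for i j
    using rot[OF that] frechet_derivative_rot_field[OF f, of i j]
    by (simp add: rot_eq[OF f that] x_def F_def Y_def B_def dx_def)
  have "x j * F i - x i * F j + (\<Sum>k\<in>UNIV. Y k j * B k i - Y k i * B k j) = 0" for i j
  proof (cases i j rule: linorder_cases)
    case less
    then show ?thesis by (rule eq0)
  next
    case greater
    from eq0[OF this] show ?thesis by (simp add: sum_subtractf)
  qed simp
  from antisymmetric_gradient_identity[of B Y, OF B Y this]
  show ?thesis by (simp add: norm_vec_def L2_set_def hgrad_def l r)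
qed

section \<open>Left translations\<close>

text \<open>It has two roles. The product of v and p is exactly \<open>p + right_field v p\<close>,
  so this is the increment of a left translation; it is also linear in \<open>v\<close>, and is the
  right invariant field with value \<open>v\<close> at the origin.\<close>

definition right_field :: "'n::{card2,linorder} nil2 \<Rightarrow> 'n nil2 \<Rightarrow> 'n nil2" where
  "right_field v p = (fst v, snd v + area (fst v) (fst p))"

lemma affine_symmetry_translation:
  "affine_symmetry (\<lambda>p. p + right_field v p) (\<lambda>p. p + right_field (- v) p)
    (\<lambda>p. p + (0, area (fst v) (fst p))) v (\<lambda>j i. if j = i then 1 else 0)"
proof (rule affine_symmetry.intro)
  have L: "bounded_linear (\<lambda>p :: 'a nil2. (0, area (fst w) (fst p)))" for w :: "'a nil2"
    by (intro bounded_linear_Pair bounded_linear_zero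
        bounded_linear_compose[OF area.bounded_linear_right bounded_linear_fst])
  show "bounded_linear (\<lambda>p. p + (0, area (fst v) (fst p)))"
    by (intro bounded_linear_add bounded_linear_ident L)
  show "p + right_field v p = v + (p + (0, area (fst v) (fst p)))" for p
    by (simp add: right_field_def prod_eq_iff)
  show "p + right_field v p + right_field (- v) (p + right_field v p) = p" for p
    by (simp add: right_field_def prod_eq_iff area.add_right area.minus_left)
  have "right_field (- v) p = - v + (0, area (fst (- v)) (fst p))" for p
    by (simp add: right_field_def prod_eq_iff)
  then show "continuous_on UNIV (\<lambda>p. p + right_field (- v) p)"
    by (simp only:) (intro continuous_intros bounded_linear.continuous_on[OF L])
  show "lfield i p + (0, area (fst v) (fst (lfield i p)))
      = (\<Sum>j\<in>UNIV. (if j = i then 1 else 0) *\<^sub>R lfield j (p + right_field v p))" for i p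
    by (simp add: if_distrib[of "\<lambda>x. x *\<^sub>R _"] cong: if_cong)
      (simp add: lfield_def right_field_def area.add_left)
  show "(\<Sum>i\<in>UNIV. (if j = i then 1 else 0) * (if k = i then 1 else 0)) = (if j = k then 1 else 0 :: real)"
    for j k :: 'a
    by (simp add: if_distrib[of "\<lambda>x. x * _"] cong: if_cong)
qed

lemma norm_fst_le_norm: "norm (fst v) \<le> norm v" and norm_snd_le_norm: "norm (snd v) \<le> norm v"
  by (metis norm_fst_le prod.collapse) (metis norm_snd_le prod.collapse)

lemma norm_prod_shift_le:
  fixes v :: "'a::real_normed_vector \<times> 'b::real_normed_vector"
  shows "norm (fst v, snd v + z) \<le> 2 * norm v + norm z"
proof -
  have "norm (fst v, snd v + z) \<le> norm (fst v) + norm (snd v + z)" by (rule norm_Pair_le)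
  moreover have "norm (snd v + z) \<le> norm (snd v) + norm z" by (rule norm_triangle_ineq)
  ultimately show ?thesis using norm_fst_le_norm[of v] norm_snd_le_norm[of v] by linarith
qed

section \<open>Compactly supported functions\<close>

lemma C_zero_if_compact_support:
  fixes f :: "'a::euclidean_space \<Rightarrow> real"
  assumes "continuous_on UNIV f" "compact K" "\<And>p. p \<notin> K \<Longrightarrow> f p = 0"
  shows "f \<in> C_zero"
proof -
  obtain R where R: "\<And>p. p \<in> K \<Longrightarrow> norm p \<le> R"
    using compact_imp_bounded[OF assms(2)] by (meson bounded_iff)
  have "f p = 0" if "R + 1 \<le> norm p" for p
    using R[of p] assms(3)[of p] that by (cases "p \<in> K") auto
  then have "eventually (\<lambda>p. f p = 0) at_infinity" unfolding eventually_at_infinity by blast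
  then have "(f \<longlongrightarrow> 0) at_infinity" by (rule tendsto_eventually)
  with assms(1) show ?thesis by (simp add: C_zero_def)
qed

lemma uniformly_continuous_if_compact_support:
  fixes f :: "'a::euclidean_space \<Rightarrow> real"
  assumes cont: "continuous_on UNIV f" and K: "compact K" and zero: "\<And>p. p \<notin> K \<Longrightarrow> f p = 0"
  shows "uniformly_continuous_on UNIV f"
  unfolding uniformly_continuous_on_def
proof (intro allI impI)
  fix e :: real assume e: "0 < e"
  \<comment> \<open>The margin 1 ensures that two points closer than 1 both lie in \<open>K'\<close>
    as soon as one of them is in \<open>K\<close>.\<close>
  define K' where "K' = {x + y | x y. x \<in> K \<and> y \<in> cball 0 1}"
  have "compact K'" unfolding K'_def by (rule compact_sums[OF K compact_cball])
  then have "uniformly_continuous_on K' f"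
    by (intro compact_uniformly_continuous continuous_on_subset[OF cont]) auto
  then obtain d where d: "d > 0" "\<And>p q. p \<in> K' \<Longrightarrow> q \<in> K' \<Longrightarrow> dist q p < d \<Longrightarrow> dist (f q) (f p) < e"
    using e unfolding uniformly_continuous_on_def by meson
  have near: "q \<in> K'" if "p \<in> K" "dist p q \<le> 1" for p q
    using that unfolding K'_def
    by (intro CollectI exI[of _ p] exI[of _ "q - p"]) (simp add: dist_norm norm_minus_commute)
  have "dist (f q) (f p) < e" if "dist q p < min d 1" for p q
  proof (cases "p \<in> K \<or> q \<in> K")
    case True
    then have "p \<in> K'" "q \<in> K'"
      using near[of p p] near[of p q] near[of q q] near[of q p] that by (auto simp: dist_commute)
    with d(2) that show ?thesis by simp
  next
    case False
    with e zero show ?thesis by simp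
  qed
  with d(1) show "\<exists>d>0. \<forall>p\<in>UNIV. \<forall>q\<in>UNIV. dist q p < d \<longrightarrow> dist (f q) (f p) < e"
    by (intro exI[of _ "min d 1"]) simp
qed

lemma Cc_infinity_support:
  assumes "f \<in> Cc_infinity"
  obtains K where "compact K" "\<And>p. p \<notin> K \<Longrightarrow> f p = 0" "\<And>p v. p \<notin> K \<Longrightarrow> frechet_derivative f (at p) v = 0"
proof -
  define K where "K = closure {p. f p \<noteq> 0}"
  have K: "compact K" using assms by (simp add: K_def Cc_infinity_def)
  have zero: "f p = 0" if "p \<notin> K" for p
    using that closure_subset[of "{p. f p \<noteq> 0}"] by (auto simp: K_def)
  have "frechet_derivative f (at p) v = 0" if "p \<notin> K" for p v
  proof -
    have "((\<lambda>_. 0) has_derivative (\<lambda>_. 0)) (at p)" by simp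
    then have "(f has_derivative (\<lambda>_. 0)) (at p)"
      by (rule has_derivative_transform_within_open[OF _ open_Compl[OF compact_imp_closed[OF K]]])
        (use that zero in auto)
    then show ?thesis by (simp add: frechet_derivative_eqI)
  qed
  with K zero show ?thesis by (rule that)
qed

lemma Cc_infinity_differentiable: "f \<in> Cc_infinity \<Longrightarrow> f differentiable (at p)"
  using Cc_infinity_imp_Ck[of f "Suc 0"] by simp

lemma Cc_infinity_continuous_frechet_derivative:
  "f \<in> Cc_infinity \<Longrightarrow> continuous_on UNIV (\<lambda>p. frechet_derivative f (at p) v)"
  using Cc_infinity_imp_Ck[of f "Suc 0"] by simp

lemma Cc_infinity_subset_C_zero: "f \<in> Cc_infinity \<Longrightarrow> f \<in> C_zero"
  by (metis C_zero_if_compact_support Cc_infinity_support Cc_infinity_imp_Ck Ck_imp_continuous)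

text \<open>Uniformity in \<open>p\<close> comes from the uniform continuity of the finitely many
  partial derivatives; dividing \<open>e\<close> by the dimension absorbs the sum over the
  basis.\<close>

lemma Cc_infinity_uniform_linearization:
  fixes f :: "'a::euclidean_space \<Rightarrow> real"
  assumes f: "f \<in> Cc_infinity" and e: "0 < e"
  obtains d where "0 < d"
    "\<And>p w. norm w < d \<Longrightarrow> \<bar>f (p + w) - f p - frechet_derivative f (at p) w\<bar> \<le> e * norm w"
proof -
  note fd = Cc_infinity_differentiable[OF f]
  let ?D = "\<lambda>p. frechet_derivative f (at p)"
  obtain K where K: "compact K" "\<And>p. p \<notin> K \<Longrightarrow> f p = 0" "\<And>p v. p \<notin> K \<Longrightarrow> ?D p v = 0"
    by (rule Cc_infinity_support[OF f]) blast
  define e' where "e' = e / real DIM('a)"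
  have e': "0 < e'" using e by (simp add: e'_def)
  have "uniformly_continuous_on UNIV (\<lambda>p. ?D p b)" for b
    by (rule uniformly_continuous_if_compact_support[OF Cc_infinity_continuous_frechet_derivative[OF f] K(1)])
      (rule K(3))
  then have "\<exists>d>0. \<forall>p q. dist q p < d \<longrightarrow> dist (?D q b) (?D p b) < e'" for b
    using e' unfolding uniformly_continuous_on_def by simp
  then obtain d where d: "\<And>b. d b > 0" "\<And>b p q. dist q p < d b \<Longrightarrow> dist (?D q b) (?D p b) < e'"
    by metis
  define d' where "d' = Min (d ` Basis)"
  have d': "0 < d'" "\<And>b. b \<in> Basis \<Longrightarrow> d' \<le> d b"
    using d(1) by (auto simp: d'_def)
  have close: "\<bar>?D q w - ?D p w\<bar> \<le> e * norm w" if "dist q p < d'" for p q w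
  proof -
    have "?D q w - ?D p w = (\<Sum>b\<in>Basis. (w \<bullet> b) * (?D q b - ?D p b))"
      by (simp only: frechet_derivative_expand[OF fd, of _ w] sum_subtractf right_diff_distrib)
    also have "\<bar>\<dots>\<bar> \<le> (\<Sum>b\<in>(Basis :: 'a set). norm w * e')"
    proof (rule sum_abs[THEN order_trans], rule sum_mono)
      fix b :: 'a assume b: "b \<in> Basis"
      have "\<bar>w \<bullet> b\<bar> \<le> norm w" by (rule Basis_le_norm[OF b])
      moreover have "\<bar>?D q b - ?D p b\<bar> \<le> e'"
        using d(2)[of q p b] d'(2)[OF b] that by (simp add: dist_real_def)
      ultimately show "\<bar>(w \<bullet> b) * (?D q b - ?D p b)\<bar> \<le> norm w * e'"
        unfolding abs_mult by (intro mult_mono) auto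
    qed
    also have "\<dots> = e * norm w" by (simp add: e'_def)
    finally show ?thesis .
  qed
  have "\<bar>f (p + w) - f p - ?D p w\<bar> \<le> e * norm w" if w: "norm w < d'" for p w
  proof -
    have "norm (f (p + w) - f p - ?D p (p + w - p)) \<le> norm (p + w - p) * e"
    proof (rule differentiable_bound_linearization[where S = "ball p d'"])
      show "p + t *\<^sub>R (p + w - p) \<in> ball p d'" if "t \<in> {0..1}" for t
      proof -
        have "\<bar>t\<bar> * norm w \<le> 1 * norm w" using that by (intro mult_right_mono) auto
        with w show ?thesis by (simp add: dist_norm)
      qed
      show "(f has_derivative ?D x) (at x within ball p d')" for x
        by (rule has_derivative_at_withinI[OF has_frechet_derivative[OF fd]])
      show "onorm (?D x - ?D p) \<le> e" if "x \<in> ball p d'" for x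
        using that e close[of x p] by (intro onorm_bound) (auto simp: dist_commute)
    qed (use d' in simp)
    then show ?thesis by (simp add: mult.commute)
  qed
  with d'(1) show ?thesis by (rule that)
qed

definition right_derivative :: "'n::{card2,linorder} nil2 \<Rightarrow> ('n nil2 \<Rightarrow> real) \<Rightarrow> 'n nil2 \<Rightarrow> real" where
  "right_derivative v f p = frechet_derivative f (at p) (right_field v p)"

lemma continuous_on_right_field: "continuous_on UNIV (right_field v)"
  unfolding right_field_def[abs_def]
  by (intro continuous_intros bounded_linear.continuous_on[OF area.bounded_linear_right])

lemma right_derivative_C_zero:
  assumes f: "f \<in> Cc_infinity"
  shows "right_derivative v f \<in> C_zero"
proof -
  obtain K where K: "compact K" "\<And>p. p \<notin> K \<Longrightarrow> f p = 0"
    "\<And>p v. p \<notin> K \<Longrightarrow> frechet_derivative f (at p) v = 0"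
    by (rule Cc_infinity_support[OF f]) blast
  have "right_derivative v f
      = (\<lambda>p. \<Sum>b\<in>Basis. (right_field v p \<bullet> b) * frechet_derivative f (at p) b)"
    unfolding right_derivative_def[abs_def]
    by (rule ext) (rule frechet_derivative_expand[OF Cc_infinity_differentiable[OF f]])
  moreover have "continuous_on UNIV
      (\<lambda>p. \<Sum>b\<in>Basis. (right_field v p \<bullet> b) * frechet_derivative f (at p) b)"
    by (intro continuous_intros continuous_on_right_field Cc_infinity_continuous_frechet_derivative[OF f])
  ultimately have "continuous_on UNIV (right_derivative v f)" by simp
  then show ?thesis
    by (rule C_zero_if_compact_support[OF _ K(1)]) (simp add: right_derivative_def K(3))
qed

lemma right_derivative_linear:
  assumes f: "f \<in> Cc_infinity"
  shows "right_derivative (a *\<^sub>R v + b *\<^sub>R w) f p = a * right_derivative v f p + b * right_derivative w f p"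
proof -
  interpret D: linear "frechet_derivative f (at p)"
    by (rule linear_frechet_derivative[OF Cc_infinity_differentiable[OF f]])
  have "right_field (a *\<^sub>R v + b *\<^sub>R w) p = a *\<^sub>R right_field v p + b *\<^sub>R right_field w p"
    by (simp add: right_field_def prod_eq_iff area.add_left area.scaleR_left algebra_simps)
  then show ?thesis by (simp add: right_derivative_def D.add D.scaleR)
qed

text \<open>The increment \<open>right_field v q\<close> is not bounded in \<open>q\<close>, since
  its second layer grows with the first layer of \<open>q\<close>. Where that layer has norm at most
  \<open>r + 1\<close>, the increment is at most \<open>C * norm v\<close>. Beyond, as
  \<open>norm v\<close> is below 1, neither \<open>q\<close> nor its translate meets the support,
  and all terms are 0.\<close>

lemma translation_uniform_linearization:
  assumes f: "f \<in> Cc_infinity" and e: "0 < e"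
  obtains d where "0 < d"
    "\<And>v q. norm v < d \<Longrightarrow> \<bar>f (q + right_field v q) - f q - right_derivative v f q\<bar> \<le> e * norm v"
proof -
  obtain K where K: "compact K" "\<And>p. p \<notin> K \<Longrightarrow> f p = 0"
    "\<And>p v. p \<notin> K \<Longrightarrow> frechet_derivative f (at p) v = 0"
    by (rule Cc_infinity_support[OF f]) blast
  obtain r where r: "0 < r" "\<And>p. p \<in> K \<Longrightarrow> norm p \<le> r"
    using compact_imp_bounded[OF K(1)] by (meson bounded_pos)
  obtain A where A: "0 < A" "\<And>a b. norm (area a (b :: (real, 'a) vec)) \<le> norm a * norm b * A"
    using area.pos_bounded by blast
  define C where "C = 2 + (r + 1) * A"
  have C: "0 < C" using r A by (simp add: C_def add_pos_pos)
  have le: "norm (right_field v q) \<le> C * norm v" if "norm (fst q) \<le> r + 1" for v q :: "'a nil2"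
  proof -
    have "norm (area (fst v) (fst q)) \<le> norm (fst v) * norm (fst q) * A" by (rule A(2))
    also have "\<dots> \<le> norm v * (r + 1) * A"
      using A(1) that norm_fst_le_norm[of v] r by (intro mult_right_mono mult_mono) auto
    finally show ?thesis
      using norm_prod_shift_le[of v "area (fst v) (fst q)"]
      by (simp add: right_field_def C_def algebra_simps)
  qed
  have "0 < e / C" using e C by simp
  then obtain d where d: "0 < d"
    "\<And>p w. norm w < d \<Longrightarrow> \<bar>f (p + w) - f p - frechet_derivative f (at p) w\<bar> \<le> e / C * norm w"
    by (rule Cc_infinity_uniform_linearization[OF f]) blast
  have "\<bar>f (q + right_field v q) - f q - right_derivative v f q\<bar> \<le> e * norm v"
    if v: "norm v < min 1 (d / C)" for v q
  proof (cases "norm (fst q) \<le> r + 1")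
    case True
    have "norm (right_field v q) < d"
      using le[OF True, of v] v C by (simp add: pos_less_divide_eq mult.commute)
    then have "\<bar>f (q + right_field v q) - f q - right_derivative v f q\<bar> \<le> e / C * norm (right_field v q)"
      unfolding right_derivative_def by (rule d(2))
    also have "\<dots> \<le> e / C * (C * norm v)" using le[OF True] e C by (intro mult_left_mono) auto
    finally show ?thesis using C by simp
  next
    case False
    have "norm (fst q) \<le> norm (fst q + fst v) + norm (fst v)"
      using norm_triangle_ineq4[of "fst q + fst v" "fst v"] by simp
    then have "r < norm (fst (q + right_field v q))"
      using False v norm_fst_le_norm[of v] by (simp add: right_field_def)
    then have "q + right_field v q \<notin> K"
      using r(2)[of "q + right_field v q"] norm_fst_le_norm[of "q + right_field v q"] by linarith
    moreover have "q \<notin> K" using r(2)[of q] norm_fst_le_norm[of q] False by linarith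
    ultimately show ?thesis using e by (simp add: right_derivative_def K)
  qed
  moreover have "0 < min 1 (d / C)" using d C by simp
  ultimately show ?thesis using that by blast
qed

section \<open>The heat semigroup\<close>

lemma c0_fun_sum: "c0_fun (\<Sum>i\<in>A. x i) p = (\<Sum>i\<in>A. c0_fun (x i) p)"
  by (induction A rule: infinite_finite_induct) simp_all

context
  fixes P :: "real \<Rightarrow> ('n::{card2,linorder} nil2 \<Rightarrow> real) \<Rightarrow> ('n nil2 \<Rightarrow> real)"
  assumes heat: "heat_semigroup P"
begin

lemma heat_C0_semigroup: "C0_semigroup P"
  using heat by (simp add: heat_semigroup_def)

interpretation S: strongly_continuous_semigroup "\<lambda>t. c0_op (P t)"
  by (rule strongly_continuous_semigroup_c0_op[OF heat_C0_semigroup])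

lemma heat_gen_iff: "(x, y) \<in> S.gen \<longleftrightarrow> (c0_fun x, c0_fun y) \<in> closure_graph subLaplacian"
  using heat by (simp add: gen_c0_op_iff[OF heat_C0_semigroup] heat_semigroup_def)

section \<open>Positivity, contraction and symmetries of the heat semigroup\<close>

lemma heat_gen_dissipative:
  assumes "(x, y) \<in> S.gen" "0 < h"
  shows "pos_sup x \<le> pos_sup (x - h *\<^sub>R y)"
proof (rule pos_sup_le[OF pos_sup_nonneg])
  show "c0_fun x p \<le> pos_sup (x - h *\<^sub>R y)" for p
    using assms(1)[unfolded heat_gen_iff] assms(2) pos_sup_nonneg
  proof (rule closure_graph_dissipative)
    show "c0_fun x q - h * c0_fun y q \<le> pos_sup (x - h *\<^sub>R y)" for q
      using c0_fun_le_pos_sup[of "x - h *\<^sub>R y" q] by simp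
  qed
qed

lemma heat_pos_sup_le: "0 \<le> t \<Longrightarrow> pos_sup (c0_op (P t) x) \<le> pos_sup x"
  by (rule S.dissipative_imp_contractive[OF pos_sup_add pos_sup_le_norm heat_gen_dissipative])

lemma heat_mono:
  assumes t: "0 \<le> t" and fg: "f \<in> C_zero" "g \<in> C_zero" and le: "\<And>q. f q \<le> g q"
  shows "P t f p \<le> P t g p"
proof -
  define x where "x = Abs_c0 f - Abs_c0 g"
  have x: "c0_fun x = (\<lambda>q. f q - g q)" by (simp add: x_def Abs_c0_inverse fg fun_eq_iff)
  have "pos_sup (c0_op (P t) x) \<le> pos_sup x" by (rule heat_pos_sup_le[OF t])
  also have "\<dots> \<le> 0" using le by (intro pos_sup_le) (auto simp: x)
  finally have "P t (\<lambda>q. f q - g q) p \<le> 0"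
    using c0_fun_le_pos_sup[of "c0_op (P t) x" p]
    by (simp add: c0_fun_c0_op[OF heat_C0_semigroup t] x)
  then show ?thesis
    using C0_semigroup_linear[OF heat_C0_semigroup t fg, of 1 "-1"] by simp
qed

lemma heat_abs_le:
  assumes t: "0 \<le> t" and f: "f \<in> C_zero" and le: "\<And>q. \<bar>f q\<bar> \<le> B"
  shows "\<bar>P t f p\<bar> \<le> B"
proof -
  have B: "0 \<le> B" using le[of p] by linarith
  have *: "c0_fun (c0_op (P t) x) p \<le> B" if "\<And>q. \<bar>c0_fun x q\<bar> \<le> B" for x
  proof -
    have "c0_fun (c0_op (P t) x) p \<le> pos_sup x"
      using c0_fun_le_pos_sup heat_pos_sup_le[OF t] order_trans by blast
    also have "\<dots> \<le> B" using that B by (intro pos_sup_le) (auto simp: abs_le_iff)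
    finally show ?thesis .
  qed
  interpret T: bounded_linear "c0_op (P t)" by (rule S.blin[OF t])
  have "c0_fun (c0_op (P t) (Abs_c0 f)) p \<le> B" "c0_fun (c0_op (P t) (- Abs_c0 f)) p \<le> B"
    by (rule *, simp add: Abs_c0_inverse f le)+
  then show ?thesis
    by (simp add: T.neg c0_fun_c0_op[OF heat_C0_semigroup t] Abs_c0_inverse f)
qed

lemma heat_compose:
  assumes "affine_symmetry phi psi L c R" and t: "0 \<le> t" and f: "f \<in> C_zero"
  shows "P t (\<lambda>p. f (phi p)) = (\<lambda>p. P t f (phi p))"
proof -
  interpret affine_symmetry phi psi L c R by fact
  define U where "U x = Abs_c0 (\<lambda>p. c0_fun x (phi p))" for x
  have U: "c0_fun (U x) = (\<lambda>p. c0_fun x (phi p))" for x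
    unfolding U_def by (intro Abs_c0_inverse C_zero_compose c0_fun)
  have bl: "bounded_linear U"
  proof (rule bounded_linear_intro)
    show "U (x + y) = U x + U y" for x y by (rule c0_eqI) (simp add: U)
    show "U (r *\<^sub>R x) = r *\<^sub>R U x" for r x by (rule c0_eqI) (simp add: U)
    show "norm (U x) \<le> norm x * 1" for x by (rule c0_norm_le) (simp add: U abs_c0_fun_le_norm)
  qed
  have gen: "(U x, U y) \<in> S.gen" if "(x, y) \<in> S.gen" for x y
    using closure_graph_compose[OF that[unfolded heat_gen_iff]] by (simp add: heat_gen_iff U)
  have "c0_op (P t) (U (Abs_c0 f)) = U (c0_op (P t) (Abs_c0 f))"
    by (rule S.commutes_with_symmetry[OF pos_sup_add pos_sup_le_norm pos_sup_definite
          heat_gen_dissipative bl gen t])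
  then have "c0_fun (c0_op (P t) (U (Abs_c0 f))) = c0_fun (U (c0_op (P t) (Abs_c0 f)))" by (rule arg_cong)
  then show ?thesis by (simp add: U c0_fun_c0_op[OF heat_C0_semigroup t] Abs_c0_inverse f)
qed

section \<open>Differentiability of the semigroup on test functions\<close>

text \<open>
  \<open>P t f (p + w) - P t f p\<close> is the value at \<open>p\<close> of \<open>P t\<close> applied to the increment of \<open>f\<close> under
  the left translation that moves \<open>p\<close> to \<open>p + w\<close>.
\<close>

lemma heat_has_derivative:
  assumes t: "0 \<le> t" and f: "f \<in> Cc_infinity"
  shows "(P t f has_derivative
    (\<lambda>w. P t (right_derivative (fst w, snd w - area (fst w) (fst p)) f) p)) (at p)"
proof -
  \<comment> \<open>\<open>V w\<close> is the value at the origin of the right invariant field that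
    equals \<open>w\<close> at \<open>p\<close>; translating by it moves \<open>p\<close> to
    \<open>p + w\<close>.\<close>
  define V where "V w = (fst w, snd w - area (fst w) (fst p))" for w :: "'n nil2"
  have V_field: "right_field (V w) p = w" for w by (simp add: V_def right_field_def)
  have V_add: "V (w + w') = V w + V w'" and V_scaleR: "V (r *\<^sub>R w) = r *\<^sub>R V w" for w w' r
    by (simp_all add: V_def area.add_left area.scaleR_left algebra_simps)
  note RC = right_derivative_C_zero[OF f] and fC = Cc_infinity_subset_C_zero[OF f]
  note lin = C0_semigroup_linear[OF heat_C0_semigroup t]
  have lin_R: "P t (right_derivative (a *\<^sub>R v + b *\<^sub>R w) f) p
      = a * P t (right_derivative v f) p + b * P t (right_derivative w f) p" for a b v w
  proof -
    have "right_derivative (a *\<^sub>R v + b *\<^sub>R w) f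
        = (\<lambda>q. a * right_derivative v f q + b * right_derivative w f q)"
      by (rule ext) (rule right_derivative_linear[OF f])
    then show ?thesis by (simp add: lin[OF RC RC])
  qed
  have "linear (\<lambda>w. P t (right_derivative (V w) f) p)"
  proof (rule linearI)
    show "P t (right_derivative (V (w + w')) f) p
        = P t (right_derivative (V w) f) p + P t (right_derivative (V w') f) p" for w w'
      using lin_R[of 1 "V w" 1 "V w'"] by (simp add: V_add)
    show "P t (right_derivative (V (r *\<^sub>R w)) f) p = r *\<^sub>R P t (right_derivative (V w) f) p" for r w
      using lin_R[of r "V w" 0 0] by (simp add: V_scaleR)
  qed
  then have bl: "bounded_linear (\<lambda>w. P t (right_derivative (V w) f) p)"
    by (simp add: linear_conv_bounded_linear)
  obtain A where A: "0 < A" "\<And>a b. norm (area a (b :: (real, 'n) vec)) \<le> norm a * norm b * A"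
    using area.pos_bounded by blast
  define C where "C = 2 + norm (fst p) * A"
  have C: "0 < C" using A by (simp add: C_def add_pos_nonneg)
  have V_le: "norm (V w) \<le> C * norm w" for w
  proof -
    have "norm (area (fst w) (fst p)) \<le> norm (fst w) * norm (fst p) * A" by (rule A(2))
    also have "\<dots> \<le> norm w * norm (fst p) * A"
      using A(1) norm_fst_le_norm[of w] by (intro mult_right_mono) auto
    finally show ?thesis
      using norm_prod_shift_le[of w "- area (fst w) (fst p)"] by (simp add: V_def C_def algebra_simps)
  qed
  have "\<exists>d>0. \<forall>y. norm (y - p) < d \<longrightarrow>
      norm (P t f y - P t f p - P t (right_derivative (V (y - p)) f) p) \<le> e * norm (y - p)"
    if e: "0 < e" for e
  proof -
    have "0 < e / C" using e C by simp
    then obtain d where d: "0 < d"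
      "\<And>v q. norm v < d \<Longrightarrow> \<bar>f (q + right_field v q) - f q - right_derivative v f q\<bar> \<le> e / C * norm v"
      by (rule translation_uniform_linearization[OF f]) blast
    have "norm (P t f y - P t f p - P t (right_derivative (V (y - p)) f) p) \<le> e * norm (y - p)"
      if y: "norm (y - p) < d / C" for y
    proof -
      define v where "v = V (y - p)"
      have nv: "norm v \<le> C * norm (y - p)" by (simp add: v_def V_le)
      also have "\<dots> < d" using y C by (simp add: pos_less_divide_eq mult.commute)
      finally have vd: "norm v < d" .
      interpret tr: affine_symmetry "\<lambda>p. p + right_field v p" "\<lambda>p. p + right_field (- v) p"
        "\<lambda>p. p + (0, area (fst v) (fst p))" v "\<lambda>j i. if j = i then 1 else 0"
        by (rule affine_symmetry_translation)
      have trC: "(\<lambda>q. f (q + right_field v q)) \<in> C_zero" by (rule tr.C_zero_compose[OF fC])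
      have y_eq: "p + right_field v p = y" by (simp add: v_def V_field)
      have diffC: "(\<lambda>q. f (q + right_field v q) - f q) \<in> C_zero"
        using C_zero_linear_combination[OF trC fC, of 1 "-1"] by simp
      have "P t (\<lambda>q. f (q + right_field v q)) p = P t f y"
        using fun_cong[OF heat_compose[OF affine_symmetry_translation t fC], of v p] by (simp add: y_eq)
      moreover have "P t (\<lambda>q. f (q + right_field v q) - f q) p
          = P t (\<lambda>q. f (q + right_field v q)) p - P t f p"
        using fun_cong[OF lin[OF trC fC, of 1 "-1"], of p] by simp
      moreover have "P t (\<lambda>q. f (q + right_field v q) - f q - right_derivative v f q) p
          = P t (\<lambda>q. f (q + right_field v q) - f q) p - P t (right_derivative v f) p"
        using fun_cong[OF lin[OF diffC RC, of 1 "-1" v], of p] by simp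
      moreover have "(\<lambda>q. f (q + right_field v q) - f q - right_derivative v f q) \<in> C_zero"
        using C_zero_linear_combination[OF diffC RC, of 1 "-1" v] by simp
      \<comment> \<open>The contraction bound turns the uniform remainder estimate for
        \<open>f\<close> into one for \<open>P t f\<close> at \<open>p\<close>; this is why the
        linearization had to be uniform over the whole group.\<close>
      then have "\<bar>P t (\<lambda>q. f (q + right_field v q) - f q - right_derivative v f q) p\<bar> \<le> e / C * norm v"
        by (rule heat_abs_le[OF t]) (rule d(2)[OF vd])
      moreover have "e / C * norm v \<le> e / C * (C * norm (y - p))"
        using nv e C by (intro mult_left_mono) auto
      ultimately show ?thesis using C by (simp add: v_def)
    qed
    moreover have "0 < d / C" using d(1) C by simp
    ultimately show ?thesis by blast
  qed
  with bl have "(P t f has_derivative (\<lambda>w. P t (right_derivative (V w) f) p)) (at p)"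
    unfolding has_derivative_at_alt by blast
  then show ?thesis by (simp add: V_def)
qed

text \<open>In the direction \<open>right_field (a, 0) p\<close> the two area terms cancel, leaving
  the vector (a, 0) for every \<open>p\<close>. The derivative is then \<open>P t\<close> of one
  fixed function.\<close>

lemma heat_right_derivative:
  assumes "0 \<le> t" "f \<in> Cc_infinity"
  shows "right_derivative (a, 0) (P t f) p = P t (right_derivative (a, 0) f) p"
  by (simp add: right_derivative_def[of _ "P t f"] frechet_derivative_eqI[OF heat_has_derivative[OF assms]]
      right_field_def)

lemma heat_linear_sum:
  assumes t: "0 \<le> t" and g: "\<And>i. g i \<in> C_zero"
  shows "(\<lambda>q. \<Sum>i\<in>A. c i * g i q) \<in> C_zero"
    and "P t (\<lambda>q. \<Sum>i\<in>A. c i * g i q) p = (\<Sum>i\<in>A. c i * P t (g i) p)"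
proof -
  interpret T: bounded_linear "c0_op (P t)" by (rule S.blin[OF t])
  define x where "x = (\<Sum>i\<in>A. c i *\<^sub>R Abs_c0 (g i))"
  have x: "c0_fun x = (\<lambda>q. \<Sum>i\<in>A. c i * g i q)"
    by (simp add: x_def c0_fun_sum Abs_c0_inverse g fun_eq_iff)
  then show "(\<lambda>q. \<Sum>i\<in>A. c i * g i q) \<in> C_zero" using c0_fun[of x] by simp
  have "c0_fun (c0_op (P t) x) p = (\<Sum>i\<in>A. c i * P t (g i) p)"
    by (simp add: x_def T.sum T.scaleR c0_fun_sum c0_fun_c0_op[OF heat_C0_semigroup t] Abs_c0_inverse g)
  then show "P t (\<lambda>q. \<Sum>i\<in>A. c i * g i q) p = (\<Sum>i\<in>A. c i * P t (g i) p)"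
    by (simp add: c0_fun_c0_op[OF heat_C0_semigroup t] x)
qed

text \<open>Duality with the vector frozen at \<open>p\<close>: for the constants c_i = P_t g_i (p),
  the Cauchy-Schwarz inequality bounds the sum of c_i g_i by |c| |g| at every point. Positivity of
  P_t preserves this, and evaluation at \<open>p\<close> gives |c|^2 on the left.\<close>

lemma heat_L2_le:
  fixes g :: "'i::finite \<Rightarrow> 'n nil2 \<Rightarrow> real"
  assumes t: "0 \<le> t" and g: "\<And>i. g i \<in> C_zero"
    and G: "(\<lambda>q. L2_set (\<lambda>i. g i q) UNIV) \<in> C_zero"
  shows "L2_set (\<lambda>i. P t (g i) p) UNIV \<le> P t (\<lambda>q. L2_set (\<lambda>i. g i q) UNIV) p"
proof -
  define c where "c i = P t (g i) p" for i
  define s where "s = L2_set c UNIV"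
  define G where "G q = L2_set (\<lambda>i. g i q) UNIV" for q
  have G: "G \<in> C_zero" using assms(3) by (simp add: G_def[abs_def])
  have s0: "0 \<le> s" by (simp add: s_def L2_set_nonneg)
  have lin: "P t (\<lambda>q. r * G q) p = r * P t G p" for r
    using fun_cong[OF C0_semigroup_linear[OF heat_C0_semigroup t G G, of r 0], of p] by simp
  have sG: "(\<lambda>q. r * G q) \<in> C_zero" for r
    using C_zero_linear_combination[OF G G, of r 0] by simp
  have "s * s = (\<Sum>i\<in>UNIV. c i * P t (g i) p)"
    by (simp add: s_def L2_set_def sum_nonneg power2_eq_square flip: c_def)
  also have "\<dots> = P t (\<lambda>q. \<Sum>i\<in>UNIV. c i * g i q) p"
    by (rule heat_linear_sum(2)[OF t g, symmetric])
  also have "\<dots> \<le> P t (\<lambda>q. s * G q) p"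
  proof (rule heat_mono[OF t heat_linear_sum(1)[OF t g] sG])
    fix q
    have "(\<Sum>i\<in>UNIV. c i * g i q) \<le> (\<Sum>i\<in>UNIV. \<bar>c i\<bar> * \<bar>g i q\<bar>)"
      by (intro sum_mono) (simp flip: abs_mult)
    also have "\<dots> \<le> s * G q" unfolding s_def G_def by (rule L2_set_mult_ineq)
    finally show "(\<Sum>i\<in>UNIV. c i * g i q) \<le> s * G q" .
  qed
  finally have le: "s * s \<le> s * P t G p" by (simp add: lin)
  have "P t (\<lambda>q. 0 * G q) p \<le> P t G p"
    by (rule heat_mono[OF t sG G]) (simp add: G_def L2_set_nonneg)
  then have "0 \<le> P t G p" using lin[of 0] by simp
  \<comment> \<open>Division by \<open>s\<close> settles the case of positive \<open>s\<close>; for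
    \<open>s\<close> equal to 0 the claim is the positivity just shown.\<close>
  then have "s \<le> P t G p" using le s0 by (cases "s = 0") auto
  then show ?thesis by (simp add: s_def c_def[abs_def] G_def[abs_def])
qed

end

lemma right_derivative_axis: "right_derivative (axis i 1, 0) f p = frechet_derivative f (at p) (rfield i p)"
  by (simp add: right_derivative_def right_field_def rfield_def)

theorem proposition4p3:
  fixes P :: "real \<Rightarrow> ('n::{card2,linorder} nil2 \<Rightarrow> real) \<Rightarrow> ('n nil2 \<Rightarrow> real)"
    and f :: "'n nil2 \<Rightarrow> real" and t :: real and p :: "'n nil2"
  assumes "heat_semigroup P"
    and "f \<in> Cc_infinity"
    and "radial f"
    and "0 \<le> t"
  shows "norm (hgrad (P t f) p) \<le> P t (\<lambda>q. norm (hgrad f q)) p"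
proof -
  note f = assms(2) and t = assms(4)
  have rot_f: "rot i j f q = 0" if "i < j" for i j q
    using assms(3) that unfolding radial_def by blast
  have Pf: "P t f differentiable (at q)" for q
    by (rule differentiableI[OF heat_has_derivative[OF assms(1) t f]])
  have rot_Pf: "rot i j (P t f) q = 0" if ij: "i < j" for i j q
  \<comment> \<open>Radiality is transferred through the finite rotations: \<open>f\<close> is
    invariant under them, \<open>P t\<close> commutes with composition by them, and differentiating
    at 0 returns to the field.\<close>
  proof (rule rot_zero_if_rotation_invariant[OF ij Pf])
    fix s
    have inv: "f (mat_act (rot_mat i j s) q) = f q" for q
      by (rule rotation_invariant_if_rot_zero[OF ij Cc_infinity_differentiable[OF f] rot_f[OF ij]])
    have "affine_symmetry (mat_act (rot_mat i j s)) (mat_act (\<lambda>k l. rot_mat i j s l k))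
        (mat_act (rot_mat i j s)) 0 (rot_mat i j s)"
      using ij by (intro affine_symmetry_mat_act rot_mat_rows rot_mat_columns) auto
    from fun_cong[OF heat_compose[OF assms(1) this t Cc_infinity_subset_C_zero[OF f]], of q]
    show "P t f (mat_act (rot_mat i j s) q) = P t f q" by (simp add: inv)
  qed
  let ?g = "\<lambda>i. right_derivative (axis i 1, 0) f"
  have grad_f: "norm (hgrad f q) = L2_set (\<lambda>i. ?g i q) UNIV" for q
    by (simp add: norm_hgrad_eq_right_gradient[OF Cc_infinity_differentiable[OF f] rot_f]
        L2_set_def right_derivative_axis)
  have grad_Pf: "norm (hgrad (P t f) p) = L2_set (\<lambda>i. P t (?g i) p) UNIV"
    by (simp add: norm_hgrad_eq_right_gradient[OF Pf rot_Pf] L2_set_def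
        flip: heat_right_derivative[OF assms(1) t f] right_derivative_axis)
  have gC: "?g i \<in> C_zero" for i by (rule right_derivative_C_zero[OF f])
  \<comment> \<open>The length of the gradient can fail to be smooth where it vanishes, but it lies
    in \<open>C_zero\<close>, where the semigroup laws determine \<open>P t\<close>.\<close>
  have "(\<lambda>q. L2_set (\<lambda>i. ?g i q) UNIV) \<in> C_zero"
    unfolding C_zero_def
  proof (intro CollectI conjI)
    show "continuous_on UNIV (\<lambda>q. L2_set (\<lambda>i. ?g i q) UNIV)"
      using gC unfolding L2_set_def C_zero_def by (intro continuous_intros) simp
    have lim: "(?g i \<longlongrightarrow> 0) at_infinity" for i using gC[of i] by (simp add: C_zero_def)
    have "((\<lambda>q. L2_set (\<lambda>i. ?g i q) UNIV) \<longlongrightarrow> L2_set (\<lambda>i. 0) (UNIV :: 'n set)) at_infinity"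
      unfolding L2_set_def by (intro tendsto_intros lim)
    then show "((\<lambda>q. L2_set (\<lambda>i. ?g i q) UNIV) \<longlongrightarrow> 0) at_infinity" by (simp add: L2_set_def)
  qed
  from heat_L2_le[OF assms(1) t gC this, of p] show ?thesis
    by (simp only: grad_f[abs_def] grad_Pf)
qed

end
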